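(* For any integers $d,k\geq 1$ and any $\alpha\in(0,1)$, there exists a constant $C$ such that the following holds. Let $H_n$ be an $n$-vertex graph with minimum degree at least $\alpha n$ and let $r\geq (C/n)^{1/d}$. Then asymptotically almost surely (i.e. with probability tending to $1$ as $n\to\infty$), $H_n\cup G^d(n,r)$ contains the $k$-th power of a Hamilton cycle.
   Context: Random geometric graph: let $X_1,\dots,X_n$ be independent uniform random points in $[0,1]^d$; $G^d(n,r)$ is the graph on $[n]$ with edge set $\{\{i,j\}:\|X_i-X_j\|_2\leq r\}$. For an $n$-vertex graph $H_n$ on vertex set $[n]$, $H_n\cup G^d(n,r)$ is the graph on $[n]$ with edge set $E(H_n)\cup\{\{i,j\}:\|X_i-X_j\|_2\leq r\}$. The $k$-th power of a graph $G$ is obtained from $G$ by adding an edge between any two vertices at distance at most $k$ in $G$. *)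

theory Defs
  imports "HOL-Probability.Probability"
begin

text \<open>A finite simple graph is given by its vertex set and its set of edges, where an edge
  is a two-element set of vertices.\<close>

definition simple_graph :: "'v set \<Rightarrow> 'v set set \<Rightarrow> bool" where
  "simple_graph V E \<longleftrightarrow> finite V \<and> (\<forall>e\<in>E. e \<subseteq> V \<and> card e = 2)"

definition vertex_degree :: "'v set set \<Rightarrow> 'v \<Rightarrow> nat" where
  "vertex_degree E v = card {e \<in> E. v \<in> e}"

definition min_degree :: "'v set \<Rightarrow> 'v set set \<Rightarrow> nat" where
  "min_degree V E = Min (vertex_degree E ` V)"

definition is_walk :: "'v set \<Rightarrow> 'v set set \<Rightarrow> 'v list \<Rightarrow> bool" where
  "is_walk V E xs \<longleftrightarrow>
     xs \<noteq> [] \<and> set xs \<subseteq> V \<and> (\<forall>i. Suc i < length xs \<longrightarrow> {xs ! i, xs ! Suc i} \<in> E)"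

text \<open>The distance is \<open>\<infinity>\<close> between vertices in different components.\<close>

definition graph_dist :: "'v set \<Rightarrow> 'v set set \<Rightarrow> 'v \<Rightarrow> 'v \<Rightarrow> enat" where
  "graph_dist V E u v =
     (INF xs \<in> {xs. is_walk V E xs \<and> hd xs = u \<and> last xs = v}. enat (length xs - 1))"

definition graph_power :: "'v set \<Rightarrow> 'v set set \<Rightarrow> nat \<Rightarrow> 'v set set" where
  "graph_power V E k =
     E \<union> {{u, v} | u v. u \<in> V \<and> v \<in> V \<and> u \<noteq> v \<and> graph_dist V E u v \<le> enat k}"

definition hamilton_cycle :: "'v set \<Rightarrow> 'v set set \<Rightarrow> bool" where
  "hamilton_cycle V F \<longleftrightarrow>
     (\<exists>xs. distinct xs \<and> set xs = V \<and> 3 \<le> length xs \<and>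
           F = {{xs ! i, xs ! (Suc i mod length xs)} | i. i < length xs})"

text \<open>Since a power of a graph contains the graph itself, the cycle \<open>F\<close> below is
  automatically a Hamilton cycle of the graph with edge set \<open>E\<close>.\<close>

definition contains_hamilton_cycle_power :: "nat \<Rightarrow> 'v set \<Rightarrow> 'v set set \<Rightarrow> bool" where
  "contains_hamilton_cycle_power k V E \<longleftrightarrow>
     (\<exists>F. hamilton_cycle V F \<and> graph_power V F k \<subseteq> E)"

text \<open>The dimension \<open>d\<close> is the cardinality of the index type \<open>'d\<close>; the norm on
  \<open>real ^ 'd\<close> is the Euclidean one.\<close>

definition geometric_edges ::
  "nat \<Rightarrow> real \<Rightarrow> (nat \<Rightarrow> real ^ 'd) \<Rightarrow> nat set set" where
  "geometric_edges n r X =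
     {{i, j} | i j. i \<in> {1..n} \<and> j \<in> {1..n} \<and> i \<noteq> j \<and> norm (X i - X j) \<le> r}"

text \<open>The joint law of \<open>n\<close> independent uniform points \<open>X 1, \<dots>, X n\<close> of the unit cube.\<close>

definition random_points :: "nat \<Rightarrow> (nat \<Rightarrow> real ^ 'd) measure" where
  "random_points n = (\<Pi>\<^sub>M i\<in>{1..n}. uniform_measure lborel (cbox 0 1))"

end

theory Submission
  imports Defs "HOL-Real_Asymp.Real_Asymp"
begin

text \<open>
  Cut the unit cube into about \<open>n / L\<close> equal cells of diameter at most \<open>r\<close>, where \<open>L\<close> is a large
  constant; the points of a cell form a clique of the geometric graph. A Chernoff bound and a union
  bound over the at most \<open>(n + 1) ^ k\<close> vertex sets \<open>T\<close> of size at most \<open>k\<close> show that, with high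
  probability, whenever \<open>T\<close> has linearly many common neighbours in \<open>H\<close>, all but a small proportion
  of the cells contain many of them.

  By averaging, every populous cell contains two disjoint \<open>k\<close>-sets \<open>S1\<close>, \<open>S2\<close> having linearly many
  common neighbours in \<open>H\<close>. List the populous cells cyclically in an arbitrary order. To pass from
  one cell to the next, leave through \<open>S2\<close>, walk through common neighbours of \<open>S2\<close> and then common
  neighbours of the next \<open>S1\<close>, all inside one connector cell, and enter the next cell through its
  \<open>S1\<close>. Almost every cell can serve as connector, so a greedy choice uses no cell more than twice.
  The few vertices in sparse cells are absorbed, at most one per connector, between neighbours
  of theirs in the connector cell.
\<close>

section \<open>Powers of Hamilton cycles from cyclic sequences of blocks\<close>

text \<open>Distinctness of \<open>xs\<close> recovers the position from the vertex, and each edge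
  of the cycle changes the position by 1 or -1 modulo \<open>N\<close>. The offset \<open>z\<close>
  is a signed integer because a walk may turn back or run through position 0.\<close>

lemma cycle_walk_index:
  fixes xs :: "'v list"
  defines "N \<equiv> length xs"
  assumes "distinct xs" "N > 0"
    and F: "F = {{xs ! i, xs ! (Suc i mod N)} | i. i < N}"
    and walk: "\<forall>j. Suc j < length ws \<longrightarrow> {ws ! j, ws ! Suc j} \<in> F"
    and start: "i0 < N" "ws ! 0 = xs ! i0"
    and j: "j < length ws"
  shows "\<exists>z::int. \<bar>z\<bar> \<le> int j \<and> ws ! j = xs ! nat ((int i0 + z) mod int N)"
  using j
proof (induction j)
  case 0
  show ?case using start by (intro exI[of _ 0]) auto
next
  case (Suc j)
  then obtain z where z: "\<bar>z\<bar> \<le> int j" "ws ! j = xs ! nat ((int i0 + z) mod int N)"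
    by auto
  define p where "p = nat ((int i0 + z) mod int N)"
  have pN: "p < N" and ip: "int p = (int i0 + z) mod int N"
    using \<open>N > 0\<close> by (auto simp: p_def nat_less_iff)
  from walk Suc.prems obtain a where a: "a < N"
    "{ws ! j, ws ! Suc j} = {xs ! a, xs ! (Suc a mod N)}"
    unfolding F by auto
  have SaN: "Suc a mod N < N" using \<open>N > 0\<close> by simp
  have wj: "ws ! j = xs ! p" using z(2) by (simp add: p_def)
  consider "xs ! p = xs ! a" "ws ! Suc j = xs ! (Suc a mod N)"
    | "xs ! p = xs ! (Suc a mod N)" "ws ! Suc j = xs ! a"
    using a(2) wj by (auto simp: doubleton_eq_iff)
  then show ?case
  proof cases
    case 1
    then have "p = a" using \<open>distinct xs\<close> pN a(1) by (simp add: nth_eq_iff_index_eq N_def)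
    then have "int (Suc a mod N) = (int i0 + (z + 1)) mod int N"
      using ip by (simp add: zmod_int) (metis add.assoc add.commute mod_add_right_eq)
    then have "ws ! Suc j = xs ! nat ((int i0 + (z + 1)) mod int N)"
      using 1(2) by (metis nat_int)
    then show ?thesis using z(1) by (intro exI[of _ "z + 1"]) auto
  next
    case 2
    then have "p = Suc a mod N"
      using \<open>distinct xs\<close> pN SaN by (simp add: nth_eq_iff_index_eq N_def)
    then have "(int a + 1) mod int N = (int i0 + z) mod int N"
      using ip by (simp add: zmod_int add.commute)
    then have "int a mod int N = (int i0 + (z - 1)) mod int N"
      by (metis add_diff_cancel_right' add_diff_eq mod_diff_left_eq)
    then have "ws ! Suc j = xs ! nat ((int i0 + (z - 1)) mod int N)"
      using 2(2) a(1) by (metis mod_less nat_int zmod_int)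
    then show ?thesis using z(1) by (intro exI[of _ "z - 1"]) auto
  qed
qed

text \<open>Edges are unordered, so forward offsets suffice: a backward offset from \<open>u\<close>
  to \<open>v\<close> is a forward one from \<open>v\<close> to \<open>u\<close>. Since
  \<open>k\<close> is not bounded by \<open>N\<close>, a shift by \<open>d\<close> may return to the
  same vertex; hence the inequality among the premises of \<open>E\<close>.\<close>

lemma contains_hamilton_cycle_powerI:
  fixes xs :: "'v list"
  defines "N \<equiv> length xs"
  assumes "distinct xs" "set xs = V" "3 \<le> N" "1 \<le> k"
    and E: "\<And>i d. \<lbrakk>i < N; 1 \<le> d; d \<le> k; xs ! i \<noteq> xs ! ((i + d) mod N)\<rbrakk>
              \<Longrightarrow> {xs ! i, xs ! ((i + d) mod N)} \<in> E"
  shows "contains_hamilton_cycle_power k V E"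
proof -
  define F where "F = {{xs ! i, xs ! (Suc i mod N)} | i. i < N}"
  have "hamilton_cycle V F"
    unfolding hamilton_cycle_def F_def using assms by blast
  moreover have "F \<subseteq> E"
  proof
    fix e assume "e \<in> F"
    then obtain i where i: "i < N" "e = {xs ! i, xs ! (Suc i mod N)}" by (auto simp: F_def)
    have "Suc i mod N \<noteq> i" using \<open>3 \<le> N\<close> i(1) by (cases "Suc i = N") auto
    moreover have "Suc i mod N < N" using \<open>3 \<le> N\<close> by simp
    ultimately have "xs ! i \<noteq> xs ! (Suc i mod N)"
      using \<open>distinct xs\<close> i(1) by (simp add: nth_eq_iff_index_eq N_def)
    then show "e \<in> E" using E[of i 1] i \<open>1 \<le> k\<close> by simp
  qed
  moreover have "{u, v} \<in> E" if uv: "u \<in> V" "u \<noteq> v" "graph_dist V F u v \<le> enat k" for u v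
  proof -
    \<comment> \<open>A strict bound on the infimum defining the distance yields an actual walk of
      length at most \<open>k\<close>.\<close>
    have "graph_dist V F u v < enat (Suc k)" using uv(3) by (rule le_less_trans) simp
    then obtain ws where ws: "is_walk V F ws" "hd ws = u" "last ws = v" "length ws - 1 \<le> k"
      unfolding graph_dist_def INF_less_iff by auto
    have ne: "ws \<noteq> []" using ws(1) by (simp add: is_walk_def)
    obtain i0 where i0: "i0 < N" "u = xs ! i0"
      using uv(1) \<open>set xs = V\<close> by (metis in_set_conv_nth N_def)
    have "\<exists>z::int. \<bar>z\<bar> \<le> int (length ws - 1) \<and>
        ws ! (length ws - 1) = xs ! nat ((int i0 + z) mod int (length xs))"
      by (rule cycle_walk_index[of xs F])
        (use assms ws(1,2) i0 ne in \<open>auto simp: F_def is_walk_def hd_conv_nth\<close>)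
    then obtain z :: int where z: "\<bar>z\<bar> \<le> int k" "v = xs ! nat ((int i0 + z) mod int N)"
      using ws(3,4) ne by (force simp: last_conv_nth N_def)
    define p where "p = nat ((int i0 + z) mod int N)"
    have p: "p < N" "int p = (int i0 + z) mod int N" "v = xs ! p"
      using \<open>3 \<le> N\<close> z(2) by (auto simp: p_def nat_less_iff)
    show ?thesis
    proof (cases "z \<ge> 0")
      case True
      then have "int ((i0 + nat z) mod N) = int p" using p(2) by (simp add: zmod_int)
      then have "p = (i0 + nat z) mod N" by simp
      moreover have "z \<noteq> 0" using p uv(2) i0 by (metis add_0_right mod_less nat_int of_nat_mod)
      ultimately show ?thesis using E[of i0 "nat z"] i0 p uv(2) z(1) True by auto
    next
      case False
      then have "int ((p + nat (- z)) mod N) = (int i0 + z + (- z)) mod int N"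
        using p(2) by (simp add: zmod_int mod_diff_left_eq)
      also have "\<dots> = int i0" using i0(1) by simp
      finally have "i0 = (p + nat (- z)) mod N" by simp
      then have "{xs ! p, xs ! i0} \<in> E"
        using E[of p "nat (- z)"] i0 p uv(2) z(1) False by auto
      then show ?thesis using i0 p by (simp add: insert_commute)
    qed
  qed
  ultimately show ?thesis
    unfolding contains_hamilton_cycle_power_def graph_power_def by (intro exI[of _ F]) auto
qed

lemma contains_hamilton_cycle_power_blocks:
  fixes blk :: "'v \<Rightarrow> nat"
  assumes "finite V" "1 \<le> k" "3 \<le> Q"
    and blk: "\<And>v. v \<in> V \<Longrightarrow> blk v < Q"
    and size: "\<And>b. b < Q \<Longrightarrow> k \<le> card {v \<in> V. blk v = b}"
    and E: "\<And>u v. \<lbrakk>u \<in> V; v \<in> V; u \<noteq> v; blk v = blk u \<or> blk v = Suc (blk u) mod Q\<rbrakk>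
              \<Longrightarrow> {u, v} \<in> E"
  shows "contains_hamilton_cycle_power k V E"
proof -
  \<comment> \<open>Sort the vertices by block: positions two or more blocks apart enclose a whole block.\<close>
  obtain ys where ys: "set ys = V" "distinct ys"
    using finite_distinct_list[OF \<open>finite V\<close>] by blast
  define xs where "xs = sort_key blk ys"
  define N where "N = length xs"
  have xs: "set xs = V" "distinct xs" and sorted: "sorted (map blk xs)"
    using ys by (auto simp: xs_def)
  have N: "N = card V" using xs distinct_card[of xs] by (simp add: N_def)
  define f where "f i = blk (xs ! i)" for i
  have inV: "xs ! i \<in> V" if "i < N" for i using that xs(1) by (auto simp: N_def)
  have mono: "f i \<le> f j" if "i \<le> j" "j < N" for i j
    using sorted that sorted_nth_mono[of "map blk xs" i j] by (simp add: f_def N_def)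
  \<comment> \<open>Used with \<open>I\<close> the positions strictly between two given ones: these
    number at most \<open>k - 1\<close>, too few to hold a block.\<close>
  have count: "k \<le> card I" if "b < Q" "finite I" "\<And>i. i < N \<Longrightarrow> f i = b \<Longrightarrow> i \<in> I" for b I
  proof -
    have "{v \<in> V. blk v = b} \<subseteq> (!) xs ` I"
    proof
      fix v assume "v \<in> {v \<in> V. blk v = b}"
      then obtain i where "i < N" "v = xs ! i" "f i = b"
        using xs(1) by (auto simp: in_set_conv_nth N_def f_def)
      then show "v \<in> (!) xs ` I" using that(3) by auto
    qed
    then have "card {v \<in> V. blk v = b} \<le> card I"
      using that(2) surj_card_le by blast
    then show ?thesis using size[OF that(1)] by simp
  qed
  \<comment> \<open>Together with \<open>1 \<le> k\<close> this gives \<open>k < N\<close>, so a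
    shift by at most \<open>k\<close> wraps around at most once and then lands before its starting
    position.\<close>
  have N2k: "2 * k \<le> N"
  proof -
    have "card {v \<in> V. blk v = 0} + card {v \<in> V. blk v = 1} =
        card ({v \<in> V. blk v = 0} \<union> {v \<in> V. blk v = 1})"
      using \<open>finite V\<close> by (intro card_Un_disjoint[symmetric]) auto
    also have "\<dots> \<le> N" unfolding N using \<open>finite V\<close> by (intro card_mono) auto
    finally show ?thesis using size[of 0] size[of 1] \<open>3 \<le> Q\<close> by simp
  qed
  have N3: "3 \<le> N"
  proof -
    have "{v \<in> V. blk v = b} \<noteq> {}" if "b < 3" for b
      using size[of b] \<open>1 \<le> k\<close> \<open>3 \<le> Q\<close> that by force
    then have "b \<in> blk ` V" if "b < 3" for b using that by blast
    from this[of 0] this[of 1] this[of 2] have "{0,1,2} \<subseteq> blk ` V" by simp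
    then have "card {0,1,2::nat} \<le> card V" using \<open>finite V\<close> surj_card_le by blast
    then show ?thesis using N by simp
  qed
  have "{xs ! i, xs ! ((i + d) mod N)} \<in> E"
    if i: "i < N" and d: "1 \<le> d" "d \<le> k" and ne: "xs ! i \<noteq> xs ! ((i + d) mod N)" for i d
  proof -
    define j where "j = (i + d) mod N"
    have jN: "j < N" using i by (auto simp: j_def)
    have "f j = f i \<or> f j = Suc (f i) mod Q"
    proof (cases "i + d < N")
      case True
      then have j: "j = i + d" by (simp add: j_def)
      have le: "f i \<le> f j" using j jN mono by simp
      have fj: "f j < Q" using blk inV jN by (simp add: f_def)
      show ?thesis
      proof (rule ccontr)
        assume a: "\<not> ?thesis"
        then have "f j \<noteq> Suc (f i)" using fj by auto
        with a le have gt: "Suc (f i) < f j" by simp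
        have "k \<le> card {i<..<j}"
        proof (rule count)
          show "Suc (f i) < Q" using gt fj by simp
          fix l assume l: "l < N" "f l = Suc (f i)"
          then show "l \<in> {i<..<j}" using mono[of l i] mono[of j l] gt i
            by (metis Suc_n_not_le_n greaterThanLessThan_iff leD linorder_le_less_linear)
        qed simp
        then show False using d j by simp
      qed
    next
      case False
      then have j: "j = i + d - N" "j < i" using i d N2k \<open>1 \<le> k\<close>
        by (auto simp: j_def mod_if)
      \<comment> \<open>These are the \<open>d - 1\<close> positions strictly between
        \<open>i\<close> and \<open>j\<close> across the end of the list. Neither the last block nor
        block 0 can lie entirely among them, which forces \<open>i\<close> into the last block and
        \<open>j\<close> into block 0.\<close>
      have fin: "finite ({i<..<N} \<union> {..<j})" by simp
      have card: "card ({i<..<N} \<union> {..<j}) < k"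
      proof -
        have "card ({i<..<N} \<union> {..<j}) \<le> (N - Suc i) + j"
          using card_Un_le[of "{i<..<N}" "{..<j}"] by simp
        then show ?thesis using j False d i by simp
      qed
      have "f i = Q - 1"
      proof (rule ccontr)
        assume "f i \<noteq> Q - 1"
        then have lt: "f i < Q - 1" using blk[OF inV[OF i]] by (simp add: f_def)
        have "k \<le> card ({i<..<N} \<union> {..<j})"
        proof (rule count[OF _ fin])
          show "Q - 1 < Q" using \<open>3 \<le> Q\<close> by simp
          fix l assume "l < N" "f l = Q - 1"
          then show "l \<in> {i<..<N} \<union> {..<j}" using mono[of l i] lt i by (cases "l \<le> i") auto
        qed
        with card show False by simp
      qed
      moreover have "f j = 0"
      proof (rule ccontr)
        assume "f j \<noteq> 0"
        have "k \<le> card ({i<..<N} \<union> {..<j})"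
        proof (rule count[OF _ fin])
          show "0 < Q" using \<open>3 \<le> Q\<close> by simp
          fix l assume "l < N" "f l = 0"
          then show "l \<in> {i<..<N} \<union> {..<j}"
            using mono[of j l] \<open>f j \<noteq> 0\<close> by (cases "j \<le> l") auto
        qed
        with card show False by simp
      qed
      ultimately show ?thesis using \<open>3 \<le> Q\<close> by simp
    qed
    then show ?thesis using E[OF inV[OF i] inV[OF jN]] ne by (simp add: f_def j_def)
  qed
  then show ?thesis
    using contains_hamilton_cycle_powerI[of xs V k E] xs N3 \<open>1 \<le> k\<close> by (simp add: N_def)
qed

section \<open>Greedy choices\<close>

text \<open>Assign greedily. If every option of a new element \<open>a\<close> were already used
  \<open>c\<close> times, then \<open>c * card (F a)\<close> elements would have been assigned, more
  than there are besides \<open>a\<close>.\<close>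

lemma exists_assignment_load_le:
  fixes F :: "'a \<Rightarrow> 'b set"
  assumes "finite I" and "\<And>i. i \<in> I \<Longrightarrow> finite (F i) \<and> card I \<le> c * card (F i)"
  shows "\<exists>Z. (\<forall>i\<in>I. Z i \<in> F i) \<and> (\<forall>j. card {i \<in> I. Z i = j} \<le> c)"
  using assms
proof (induction I)
  case empty
  then show ?case by simp
next
  case (insert a I)
  have "\<And>i. i \<in> I \<Longrightarrow> finite (F i) \<and> card I \<le> c * card (F i)"
    using insert.prems insert.hyps by fastforce
  then obtain Z where Z: "\<forall>i\<in>I. Z i \<in> F i" "\<forall>j. card {i \<in> I. Z i = j} \<le> c"
    using insert.IH by blast
  have "\<exists>j\<in>F a. card {i \<in> I. Z i = j} < c"
  proof (rule ccontr)
    assume "\<not> ?thesis"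
    then have *: "\<And>j. j \<in> F a \<Longrightarrow> c \<le> card {i \<in> I. Z i = j}" by force
    have fin: "finite (F a)" using insert.prems by simp
    have "c * card (F a) \<le> (\<Sum>j\<in>F a. card {i \<in> I. Z i = j})"
      using sum_bounded_below[of "F a" c] * by (simp add: mult.commute)
    also have "\<dots> = card (\<Union>j\<in>F a. {i \<in> I. Z i = j})"
      using fin \<open>finite I\<close> by (intro card_UN_disjoint[symmetric]) auto
    also have "\<dots> \<le> card I" using \<open>finite I\<close> by (intro card_mono) auto
    finally show False using insert.prems[of a] insert.hyps by simp
  qed
  then obtain j where j: "j \<in> F a" "card {i \<in> I. Z i = j} < c" by blast
  have "card {i \<in> insert a I. (Z(a := j)) i = l} \<le> c" for l
  proof (cases "l = j")
    case True
    then have "{i \<in> insert a I. (Z(a := j)) i = l} = insert a {i \<in> I. Z i = j}"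
      using insert.hyps by auto
    then show ?thesis using j(2) insert.hyps by (simp add: card_insert_if)
  next
    case False
    then have "{i \<in> insert a I. (Z(a := j)) i = l} = {i \<in> I. Z i = l}"
      using insert.hyps by auto
    then show ?thesis using Z(2) by simp
  qed
  moreover have "\<forall>i\<in>insert a I. (Z(a := j)) i \<in> F i" using Z(1) j(1) by simp
  ultimately show ?case by blast
qed

text \<open>Choose greedily: each earlier set whose pool meets \<open>P a\<close> blocks at most
  \<open>k\<close> elements of \<open>P a\<close>, and \<open>k\<close> more must remain. The
  disjunct \<open>b = a\<close> reserves these \<open>k\<close> even if \<open>P a\<close> is empty
  and so does not meet itself.\<close>

lemma exists_disjoint_subsets:
  fixes P :: "'a \<Rightarrow> 'b set"
  assumes "finite Q"
    and "\<And>a. a \<in> Q \<Longrightarrow> finite (P a) \<and> k * card {b \<in> Q. b = a \<or> P a \<inter> P b \<noteq> {}} \<le> card (P a)"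
  shows "\<exists>U. (\<forall>a\<in>Q. U a \<subseteq> P a \<and> card (U a) = k) \<and> disjoint_family_on U Q"
  using assms
proof (induction Q)
  case empty
  then show ?case by (simp add: disjoint_family_on_def)
next
  case (insert a Q)
  have "finite (P b) \<and> k * card {b' \<in> Q. b' = b \<or> P b \<inter> P b' \<noteq> {}} \<le> card (P b)" if "b \<in> Q" for b
  proof -
    have "card {b' \<in> Q. b' = b \<or> P b \<inter> P b' \<noteq> {}} \<le> card {b' \<in> insert a Q. b' = b \<or> P b \<inter> P b' \<noteq> {}}"
      using \<open>finite Q\<close> by (intro card_mono) auto
    then show ?thesis using insert.prems[of b] that
      by (meson insertI2 le_trans mult_le_mono2)
  qed
  then obtain U where U: "\<forall>b\<in>Q. U b \<subseteq> P b \<and> card (U b) = k" "disjoint_family_on U Q"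
    using insert.IH by blast
  define C where "C = {b \<in> Q. P a \<inter> P b \<noteq> {}}"
  have fin: "finite C" "finite (P a)" using insert by (auto simp: C_def)
  have "\<exists>W \<subseteq> P a - (\<Union>b\<in>C. U b). card W = k"
  proof -
    have "{b \<in> insert a Q. b = a \<or> P a \<inter> P b \<noteq> {}} = insert a C" by (auto simp: C_def)
    then have "k * Suc (card C) \<le> card (P a)"
      using insert.prems[of a] insert.hyps fin by (simp add: C_def card_insert_if)
    moreover have "card (\<Union>b\<in>C. U b) \<le> k * card C"
    proof -
      have "card (\<Union>b\<in>C. U b) \<le> (\<Sum>b\<in>C. card (U b))" using fin by (intro card_UN_le)
      also have "\<dots> = k * card C" using U(1) by (simp add: C_def)
      finally show ?thesis .
    qed
    ultimately have "k \<le> card (P a) - card (\<Union>b\<in>C. U b)" by simp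
    also have "\<dots> \<le> card (P a - (\<Union>b\<in>C. U b))"
    proof (rule diff_card_le_card_Diff)
      have "finite (U b)" if "b \<in> C" for b
        using U(1) insert.prems that finite_subset[of "U b" "P b"] by (auto simp: C_def)
      then show "finite (\<Union>b\<in>C. U b)" using fin by blast
    qed
    finally show ?thesis using obtain_subset_with_card_n by metis
  qed
  then obtain W where W: "W \<subseteq> P a - (\<Union>b\<in>C. U b)" "card W = k" by blast
  have dis: "W \<inter> U b = {}" if "b \<in> Q" for b
    using that W(1) U(1) by (cases "b \<in> C") (simp_all add: C_def, blast+)
  have "disjoint_family_on (U(a := W)) (insert a Q)"
    unfolding disjoint_family_on_def
  proof (intro ballI impI)
    fix x y assume xy: "x \<in> insert a Q" "y \<in> insert a Q" "x \<noteq> y"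
    then consider "x = a" "y \<in> Q" | "y = a" "x \<in> Q" | "x \<in> Q" "y \<in> Q" "x \<noteq> a" "y \<noteq> a"
      by blast
    then show "(U(a := W)) x \<inter> (U(a := W)) y = {}"
    proof cases
      case 3
      then show ?thesis using U(2) xy by (simp add: disjoint_family_on_def)
    qed (use xy dis in \<open>simp_all add: Int_commute\<close>)
  qed
  moreover have "\<forall>b\<in>insert a Q. (U(a := W)) b \<subseteq> P b \<and> card ((U(a := W)) b) = k"
    using U(1) W by auto
  ultimately show ?case by blast
qed

section \<open>Common neighbourhoods and connectors\<close>

text \<open>For \<open>T = {}\<close> the condition is void. This case is used twice later: to count
  all points of a cell, and for connectors that absorb no vertex.\<close>

definition common_nbrs :: "'v set \<Rightarrow> 'v set set \<Rightarrow> 'v set \<Rightarrow> 'v set" where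
  "common_nbrs V H T = {u \<in> V. \<forall>x\<in>T. {x, u} \<in> H}"

lemma common_nbrs_subset: "common_nbrs V H T \<subseteq> V"
  by (auto simp: common_nbrs_def)

lemma common_nbrs_empty [simp]: "common_nbrs V H {} = V"
  by (auto simp: common_nbrs_def)

lemma vertex_degree_eq_card_common_nbrs:
  assumes "simple_graph V H"
  shows "vertex_degree H v = card (common_nbrs V H {v})"
proof -
  have e: "card e = 2 \<and> e \<subseteq> V" if "e \<in> H" for e
    using assms that by (auto simp: simple_graph_def)
  have "bij_betw (\<lambda>u. {v, u}) (common_nbrs V H {v}) {e \<in> H. v \<in> e}"
    unfolding bij_betw_def
  proof
    show "inj_on (\<lambda>u. {v, u}) (common_nbrs V H {v})"
      by (auto simp: inj_on_def doubleton_eq_iff)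
    show "(\<lambda>u. {v, u}) ` common_nbrs V H {v} = {e \<in> H. v \<in> e}"
    proof
      show "(\<lambda>u. {v, u}) ` common_nbrs V H {v} \<subseteq> {e \<in> H. v \<in> e}"
        by (auto simp: common_nbrs_def)
      show "{e \<in> H. v \<in> e} \<subseteq> (\<lambda>u. {v, u}) ` common_nbrs V H {v}"
      proof
        fix e assume e': "e \<in> {e \<in> H. v \<in> e}"
        then have "card e = 2" using e by blast
        then obtain x y where "e = {x, y}" unfolding card_2_iff by blast
        then obtain u where "e = {v, u}" using e' by auto
        then show "e \<in> (\<lambda>u. {v, u}) ` common_nbrs V H {v}"
          using e[of e] e' by (auto simp: common_nbrs_def)
      qed
    qed
  qed
  then show ?thesis by (simp add: vertex_degree_def bij_betw_same_card)
qed

text \<open>Double counting of the edges between \<open>A\<close> and \<open>V\<close> gives a set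
  \<open>Y\<close> of at least half of \<open>\<alpha> * card V\<close> vertices with
  \<open>k\<close> or more neighbours in \<open>A\<close>. Each of them is a common neighbour of
  some \<open>k\<close>-subset of \<open>A\<close>, and there are at most \<open>2 ^ t\<close> such
  subsets, so one of them is popular.\<close>

lemma exists_subset_many_common_nbrs:
  fixes \<alpha> :: real
  assumes "finite V" and deg: "\<And>v. v \<in> V \<Longrightarrow> \<alpha> * card V \<le> card (common_nbrs V H {v})"
    and A: "A \<subseteq> V" "card A = t" and k: "1 \<le> k" "2 * k \<le> \<alpha> * t" and "0 < \<alpha>"
  shows "\<exists>S\<subseteq>A. card S = k \<and> \<alpha> / 2 / 2 ^ t * card V \<le> card (common_nbrs V H S)"
proof (rule ccontr)
  assume not: "\<not> ?thesis"
  define n where "n = card V"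
  define Y where "Y = {u \<in> V. k \<le> card {a \<in> A. {a, u} \<in> H}}"
  define K where "K = {S. S \<subseteq> A \<and> card S = k}"
  have finA: "finite A" using A \<open>finite V\<close> finite_subset by blast
  have t: "0 < t" using k by (cases t) auto
  have n: "0 < n" using t A \<open>finite V\<close> by (auto simp: n_def card_gt_0_iff)
  have finK: "finite K" and cardK: "card K \<le> 2 ^ t"
  proof -
    have "K \<subseteq> Pow A" by (auto simp: K_def)
    then show "finite K" "card K \<le> 2 ^ t"
      using finA A(2) card_mono[of "Pow A" K] finite_subset[of K "Pow A"]
      by (auto simp: card_Pow)
  qed
  have finY: "finite Y" using \<open>finite V\<close> by (simp add: Y_def)
  have Y_big: "\<alpha> / 2 * n \<le> card Y"
  proof -
    have "\<alpha> * n * t \<le> (\<Sum>a\<in>A. real (card (common_nbrs V H {a})))"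
      using sum_bounded_below[of A "\<alpha> * n" "\<lambda>a. real (card (common_nbrs V H {a}))"] deg A
      by (auto simp: n_def mult.commute)
    also have "\<dots> = real (\<Sum>a\<in>A. card {u \<in> V. {a, u} \<in> H})" by (simp add: common_nbrs_def)
    also have "(\<Sum>a\<in>A. card {u \<in> V. {a, u} \<in> H}) = (\<Sum>u\<in>V. card {a \<in> A. {a, u} \<in> H})"
      using finA \<open>finite V\<close> by (intro sum_multicount_gen) auto
    \<comment> \<open>A vertex of \<open>Y\<close> has up to \<open>t\<close> neighbours in
      \<open>A\<close>, any other fewer than \<open>k\<close>. As
      \<open>2 * k \<le> \<alpha> * t\<close>, the terms \<open>k\<close> account for at most half
      of the edges.\<close>
    also have "\<dots> \<le> (\<Sum>u\<in>V. (if u \<in> Y then t else 0) + k)"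
    proof (rule sum_mono)
      fix u assume "u \<in> V"
      have "card {a \<in> A. {a, u} \<in> H} \<le> t" using finA A(2) card_mono[of A] by auto
      then show "card {a \<in> A. {a, u} \<in> H} \<le> (if u \<in> Y then t else 0) + k"
        using \<open>u \<in> V\<close> by (auto simp: Y_def)
    qed
    also have "\<dots> = t * card Y + k * n"
      using \<open>finite V\<close> by (auto simp: sum.distrib n_def Y_def sum.If_cases Int_def conj_commute)
    finally have "\<alpha> * n * t \<le> t * card Y + k * n" by simp
    moreover have "2 * (k * real n) \<le> \<alpha> * t * n" using k(2) n by (simp add: mult_right_mono)
    ultimately have "t * (\<alpha> / 2 * n) \<le> t * card Y" by (simp add: algebra_simps)
    then show ?thesis using t by (simp only: of_nat_mult mult_le_cancel_left_pos of_nat_0_less_iff)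
  qed
  have Y_sub: "Y \<subseteq> (\<Union>S\<in>K. common_nbrs V H S)"
  proof
    fix u assume u: "u \<in> Y"
    then obtain S where "S \<subseteq> {a \<in> A. {a, u} \<in> H}" "card S = k"
      using obtain_subset_with_card_n unfolding Y_def by blast
    then show "u \<in> (\<Union>S\<in>K. common_nbrs V H S)"
      using u by (auto simp: K_def Y_def common_nbrs_def)
  qed
  have "0 < real (card Y)" using Y_big n \<open>0 < \<alpha>\<close> 
    by (smt (verit) mult_pos_pos of_nat_0_less_iff half_gt_zero)
  \<comment> \<open>Nonemptiness makes the comparison of sums over \<open>K\<close> below
    strict.\<close>
  then have K_ne: "K \<noteq> {}" using Y_sub by (auto simp: card_gt_0_iff)
  have "finite (common_nbrs V H S)" for S
    using \<open>finite V\<close> by (simp add: common_nbrs_def)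
  then have "card Y \<le> card (\<Union>S\<in>K. common_nbrs V H S)"
    using Y_sub finK by (intro card_mono) auto
  also have "\<dots> \<le> (\<Sum>S\<in>K. card (common_nbrs V H S))" using finK by (rule card_UN_le)
  finally have "real (card Y) \<le> (\<Sum>S\<in>K. real (card (common_nbrs V H S)))"
    by (simp flip: of_nat_sum)
  also have "\<dots> < (\<Sum>S\<in>K. \<alpha> / 2 / 2 ^ t * n)"
    using finK K_ne not by (intro sum_strict_mono) (auto simp: K_def n_def not_le)
  also have "\<dots> = card K * (\<alpha> / 2 / 2 ^ t * n)" by simp
  also have "\<dots> \<le> 2 ^ t * (\<alpha> / 2 / 2 ^ t * n)"
    using cardK \<open>0 < \<alpha>\<close> by (intro mult_right_mono) (auto simp flip: of_nat_le_iff)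
  also have "\<dots> = \<alpha> / 2 * n" by simp
  finally show False using Y_big by simp
qed

lemma contains_hamilton_cycle_power_connectors:
  fixes A S1 S2 P :: "nat \<Rightarrow> 'v set" and Z :: "nat \<Rightarrow> nat"
  assumes "finite V" "1 \<le> k" "0 < q" "H \<subseteq> E"
    and A: "\<And>i. i < q \<Longrightarrow> A i \<subseteq> V" "disjoint_family_on A {..<q}"
      "\<And>i. i < q \<Longrightarrow> 13 * k \<le> card (A i)"
    and clique: "\<And>i u v. \<lbrakk>i < q; u \<in> A i; v \<in> A i; u \<noteq> v\<rbrakk> \<Longrightarrow> {u, v} \<in> E"
    and S1: "\<And>i. i < q \<Longrightarrow> S1 i \<subseteq> A i \<and> card (S1 i) = k"
    and S2: "\<And>i. i < q \<Longrightarrow> S2 i \<subseteq> A i \<and> card (S2 i) = k"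
    and S12: "\<And>i. i < q \<Longrightarrow> S1 i \<inter> S2 i = {}"
    and P: "\<And>i u v. \<lbrakk>i < q; u \<in> P i; v \<in> P i\<rbrakk> \<Longrightarrow> u = v" "disjoint_family_on P {..<q}"
      "\<And>i j. \<lbrakk>i < q; j < q\<rbrakk> \<Longrightarrow> P i \<inter> A j = {}"
    and V: "V = (\<Union>i<q. A i \<union> P i)"
    and Z: "\<And>i. i < q \<Longrightarrow> Z i < q" "\<And>j. card {i \<in> {..<q}. Z i = j} \<le> 2"
    and pools: "\<And>i. i < q \<Longrightarrow> 12 * k \<le> card (A (Z i) \<inter> common_nbrs V H (S2 i))"
      "\<And>i. i < q \<Longrightarrow> 12 * k \<le> card (A (Z i) \<inter> common_nbrs V H (P i))"
      "\<And>i. i < q \<Longrightarrow> 12 * k \<le> card (A (Z i) \<inter> common_nbrs V H (S1 (Suc i mod q)))"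
  shows "contains_hamilton_cycle_power k V E"
proof -
  txt \<open>
    The round of cell \<open>i\<close> consists of eight blocks of at least \<open>k\<close> vertices, consecutive ones
    spanning a clique:
    \<open>S1 i\<close>, the unused rest \<open>R i\<close> of the cell, \<open>S2 i\<close>, then inside the connector cell \<open>Z i\<close> the sets
    \<open>U (i, 3)\<close> joined to \<open>S2 i\<close>, \<open>U (i, 4)\<close>, \<open>P i \<union> U (i, 5)\<close>, \<open>U (i, 6)\<close> joined to the absorbed
    vertex in \<open>P i\<close> (if any), and \<open>U (i, 7)\<close> joined to \<open>S1\<close> of the next cell.
    The block number is \<open>8 * i\<close> plus the position.
  \<close>
  define Q where "Q = {..<q} \<times> {3..7::nat}"
  \<comment> \<open>\<open>T i \<rho>\<close> is what the block at position \<open>\<rho>\<close>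
    has to be joined to by edges of \<open>H\<close>. Position 5 contains the absorbed vertex, so
    positions 4, 5 and 6 must all be adjacent to \<open>P i\<close>.\<close>
  define T where "T i \<rho> = (if \<rho> = 3 then S2 i else if \<rho> = 7 then S1 (Suc i mod q) else P i)"
    for i and \<rho> :: nat
  \<comment> \<open>\<open>S1\<close> and \<open>S2\<close> of the connector cell are kept out,
    since they are blocks of that cell's own round.\<close>
  define pool where "pool = (\<lambda>(i, \<rho>). A (Z i) \<inter> common_nbrs V H (T i \<rho>) - (S1 (Z i) \<union> S2 (Z i)))"
  have finA: "finite (A i)" if "i < q" for i using A(1)[OF that] \<open>finite V\<close> finite_subset by blast
  have finS: "finite (S1 i)" "finite (S2 i)" if "i < q" for i
    using S1[OF that] S2[OF that] finA[OF that] finite_subset by blast+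
  have A_inj: "i = j" if "i < q" "j < q" "v \<in> A i" "v \<in> A j" for i j v
    using A(2) that by (auto simp: disjoint_family_on_def)
  \<comment> \<open>A cell is the connector of at most two rounds, and each asks for five sets of
    size \<open>k\<close>. Adding its own \<open>S1\<close> and \<open>S2\<close> gives the
    \<open>12 * k\<close> in \<open>pools\<close>; the \<open>13 * k\<close> in the bound on
    \<open>card (A i)\<close> leaves \<open>k\<close> vertices for \<open>R i\<close>.\<close>
  have cell_load: "card {b \<in> Q. Z (fst b) = j} \<le> 10" for j
  proof -
    have "{b \<in> Q. Z (fst b) = j} = {i \<in> {..<q}. Z i = j} \<times> {3..7}" by (auto simp: Q_def)
    then show ?thesis using Z(2)[of j] by simp
  qed
  have finQ: "finite Q" by (simp add: Q_def)

  \<comment> \<open>Disjoint blocks inside the connector cells\<close>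
  have "\<exists>U. (\<forall>a\<in>Q. U a \<subseteq> pool a \<and> card (U a) = k) \<and> disjoint_family_on U Q"
  proof (rule exists_disjoint_subsets[OF finQ])
    fix a assume a: "a \<in> Q"
    obtain i \<rho> where ai: "a = (i, \<rho>)" by force
    have i: "i < q" "Z i < q" using a ai Z(1) by (auto simp: Q_def)
    \<comment> \<open>Cells are disjoint, so pools meet only if they lie in the same connector
      cell.\<close>
    have "{b \<in> Q. b = a \<or> pool a \<inter> pool b \<noteq> {}} \<subseteq> {b \<in> Q. Z (fst b) = Z i}"
    proof
      fix b assume b: "b \<in> {b \<in> Q. b = a \<or> pool a \<inter> pool b \<noteq> {}}"
      then consider "b = a" | v where "v \<in> pool a" "v \<in> pool b" by auto
      then show "b \<in> {b \<in> Q. Z (fst b) = Z i}"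
      proof cases
        case 2
        then have "v \<in> A (Z i)" "v \<in> A (Z (fst b))" by (auto simp: pool_def ai split: prod.splits)
        moreover have "Z (fst b) < q" using b Z(1) by (auto simp: Q_def)
        ultimately show ?thesis using b i A_inj by blast
      qed (use b ai in auto)
    qed
    then have "card {b \<in> Q. b = a \<or> pool a \<inter> pool b \<noteq> {}} \<le> card {b \<in> Q. Z (fst b) = Z i}"
      by (rule card_mono[rotated]) (use finQ in simp)
    then have "card {b \<in> Q. b = a \<or> pool a \<inter> pool b \<noteq> {}} \<le> 10"
      using cell_load[of "Z i"] by (rule order_trans)
    then have "k * card {b \<in> Q. b = a \<or> pool a \<inter> pool b \<noteq> {}} \<le> k * 10"
      by (rule mult_le_mono2)
    moreover have "10 * k \<le> card (pool a)"
    proof -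
      have "12 * k \<le> card (A (Z i) \<inter> common_nbrs V H (T i \<rho>))"
        using pools[OF i(1)] by (simp add: T_def)
      moreover have "card (S1 (Z i) \<union> S2 (Z i)) \<le> 2 * k"
        using card_Un_le[of "S1 (Z i)" "S2 (Z i)"] S1[OF i(2)] S2[OF i(2)] by simp
      moreover have "card (A (Z i) \<inter> common_nbrs V H (T i \<rho>)) - card (S1 (Z i) \<union> S2 (Z i))
          \<le> card (pool a)"
        unfolding pool_def ai using finS[OF i(2)] by (simp add: diff_card_le_card_Diff)
      ultimately show ?thesis by simp
    qed
    ultimately have "k * card {b \<in> Q. b = a \<or> pool a \<inter> pool b \<noteq> {}} \<le> card (pool a)"
      by linarith
    moreover have "finite (pool a)" using finA[OF i(2)] by (simp add: pool_def ai)
    ultimately show "finite (pool a) \<and> k * card {b \<in> Q. b = a \<or> pool a \<inter> pool b \<noteq> {}} \<le> card (pool a)"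
      by (rule conjI[rotated])
  qed
  then obtain U where U: "\<And>a. a \<in> Q \<Longrightarrow> U a \<subseteq> pool a \<and> card (U a) = k" "disjoint_family_on U Q"
    by blast
  have U_inj: "a = b" if "a \<in> Q" "b \<in> Q" "v \<in> U a" "v \<in> U b" for a b v
    using U(2) that by (auto simp: disjoint_family_on_def)
  have inU: "v \<in> A (Z i)" "v \<notin> S1 (Z i)" "v \<notin> S2 (Z i)" "\<And>x. x \<in> T i \<rho> \<Longrightarrow> {x, v} \<in> H"
    if "i < q" "\<rho> \<in> {3..7}" "v \<in> U (i, \<rho>)" for i \<rho> v
    using U(1)[of "(i, \<rho>)"] that by (auto simp: Q_def pool_def common_nbrs_def)
  define W where "W = (\<Union>a\<in>Q. U a)"
  define R where "R i = A i - (S1 i \<union> S2 i) - W" for i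
  have W_S: "v \<notin> S1 i \<and> v \<notin> S2 i" if "v \<in> W" "i < q" for v i
  proof -
    from that(1) obtain l \<rho> where l: "l < q" "\<rho> \<in> {3..7}" "v \<in> U (l, \<rho>)" by (auto simp: W_def Q_def)
    show ?thesis
    proof (cases "i = Z l")
      case False
      then have "v \<notin> A i" using A_inj[of i "Z l" v] inU(1)[OF l] Z(1)[OF l(1)] that(2) by blast
      then show ?thesis using S1[OF that(2)] S2[OF that(2)] by blast
    qed (use inU[OF l] in blast)
  qed
  have W_P: "v \<notin> P i" if "v \<in> W" "i < q" for v i
  proof -
    from that(1) obtain l \<rho> where l: "l < q" "\<rho> \<in> {3..7}" "v \<in> U (l, \<rho>)" by (auto simp: W_def Q_def)
    then show ?thesis using inU(1)[OF l] P(3)[OF that(2) Z(1)[OF l(1)]] by blast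
  qed
  have card_R: "k \<le> card (R i)" if i: "i < q" for i
  proof -
    have sub: "A i \<inter> W \<subseteq> (\<Union>a\<in>{b \<in> Q. Z (fst b) = i}. U a)"
    proof
      fix v assume v: "v \<in> A i \<inter> W"
      then obtain l \<rho> where l: "l < q" "\<rho> \<in> {3..7}" "v \<in> U (l, \<rho>)" by (auto simp: W_def Q_def)
      then have "Z l = i" using A_inj[of i "Z l" v] inU(1)[OF l] Z(1) i v by auto
      then show "v \<in> (\<Union>a\<in>{b \<in> Q. Z (fst b) = i}. U a)" using l by (force simp: Q_def)
    qed
    have "finite (U a)" if "a \<in> Q" for a
      using U(1)[OF that] \<open>1 \<le> k\<close> card_ge_0_finite[of "U a"] by auto
    then have "card (A i \<inter> W) \<le> card (\<Union>a\<in>{b \<in> Q. Z (fst b) = i}. U a)"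
      using sub finQ by (intro card_mono) auto
    also have "\<dots> \<le> (\<Sum>a\<in>{b \<in> Q. Z (fst b) = i}. card (U a))"
      using finQ by (intro card_UN_le) auto
    also have "\<dots> \<le> 10 * k" using U(1) cell_load[of i] by simp
    finally have "card (A i \<inter> W) \<le> 10 * k" .
    moreover have "card (S1 i \<union> S2 i) \<le> 2 * k"
      using card_Un_le[of "S1 i" "S2 i"] S1[OF i] S2[OF i] by simp
    ultimately have "card ((S1 i \<union> S2 i) \<union> (A i \<inter> W)) \<le> 12 * k"
      using card_Un_le[of "S1 i \<union> S2 i" "A i \<inter> W"] by linarith
    moreover have "card (A i) - card ((S1 i \<union> S2 i) \<union> (A i \<inter> W)) \<le>
        card (A i - ((S1 i \<union> S2 i) \<union> (A i \<inter> W)))"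
      using finA[OF i] finS[OF i] by (intro diff_card_le_card_Diff) auto
    moreover have "A i - ((S1 i \<union> S2 i) \<union> (A i \<inter> W)) = R i" by (auto simp: R_def)
    ultimately show ?thesis using A(3)[OF i] by simp
  qed

  \<comment> \<open>The position of each vertex in the cyclic sequence of blocks\<close>
  define cell where "cell v = (SOME i. i < q \<and> v \<in> A i)" for v
  define conn where "conn v = (SOME a. a \<in> Q \<and> v \<in> U a)" for v
  define bad where "bad v = (SOME i. i < q \<and> v \<in> P i)" for v
  have cell: "cell v = i" if "i < q" "v \<in> A i" for v i
    unfolding cell_def by (rule some_equality) (use that A_inj in blast)+
  have conn: "conn v = a" if "a \<in> Q" "v \<in> U a" for v a
    unfolding conn_def by (rule some_equality) (use that U_inj in blast)+
  have bad: "bad v = i" if "i < q" "v \<in> P i" for v i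
    unfolding bad_def by (rule some_equality) (use that P(2) in \<open>auto simp: disjoint_family_on_def\<close>)
  \<comment> \<open>The order of the tests matters: a vertex of \<open>W\<close> also lies in a
    cell, but belongs to the round it connects, so \<open>W\<close> is tested before the cell.
    Whatever is left over in a cell goes to position 1, the block \<open>R\<close>.\<close>
  define pos where "pos v = (if v \<in> (\<Union>i<q. P i) then (bad v, 5) else if v \<in> W then conn v
      else if v \<in> S1 (cell v) then (cell v, 0) else if v \<in> S2 (cell v) then (cell v, 2)
      else (cell v, 1::nat))" for v
  define B where "B = (\<lambda>(i, \<rho>::nat). if \<rho> = 0 then S1 i else if \<rho> = 1 then R i
      else if \<rho> = 2 then S2 i else if \<rho> = 5 then P i \<union> U (i, \<rho>) else U (i, \<rho>))"
  have pos_range: "fst (pos v) < q \<and> snd (pos v) < 8 \<and> v \<in> B (pos v)" if v: "v \<in> V" for v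
  proof -
    consider i where "i < q" "v \<in> P i" | "v \<notin> (\<Union>i<q. P i)" "v \<in> W"
      | i where "v \<notin> (\<Union>i<q. P i)" "v \<notin> W" "i < q" "v \<in> A i"
      using v V by blast
    then show ?thesis
    proof cases
      case (1 i)
      then have "pos v = (i, 5)" using bad by (auto simp: pos_def)
      then show ?thesis using 1 by (simp add: B_def)
    next
      case 2
      then obtain l \<rho> where l: "l < q" "\<rho> \<in> {3..7}" "v \<in> U (l, \<rho>)" by (auto simp: W_def Q_def)
      then have "pos v = (l, \<rho>)" using 2 conn[of "(l, \<rho>)" v] by (simp add: pos_def Q_def)
      then show ?thesis using l by (auto simp: B_def)
    next
      case (3 i)
      then show ?thesis using cell[OF 3(3,4)] by (auto simp: pos_def B_def R_def)
    qed
  qed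
  have A_P: "v \<notin> (\<Union>i<q. P i)" if "i < q" "v \<in> A i" for v i
    using P(3)[OF _ that(1)] that(2) by blast
  \<comment> \<open>This provides the lower bounds on block sizes. At position 5 the
    \<open>k\<close> vertices come from \<open>U (i, 5)\<close> alone, as \<open>P i\<close> may be
    empty.\<close>
  have pos_core: "pos v = (i, \<rho>)" "v \<in> V"
    if i: "i < q" "\<rho> < 8" and v: "v \<in> (if \<rho> = 5 then U (i, \<rho>) else B (i, \<rho>))" for v i \<rho>
  proof -
    consider "\<rho> \<in> {3..7}" "v \<in> U (i, \<rho>)" | "\<rho> = 0" "v \<in> S1 i" | "\<rho> = 1" "v \<in> R i"
      | "\<rho> = 2" "v \<in> S2 i"
      using i(2) v by (force simp: B_def split: if_splits)
    then have "pos v = (i, \<rho>) \<and> v \<in> V"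
    proof cases
      case 1
      then have a: "(i, \<rho>) \<in> Q" using i by (simp add: Q_def)
      then have W: "v \<in> W" using 1(2) unfolding W_def by blast
      then have "v \<notin> (\<Union>i<q. P i)" using W_P by blast
      then have "pos v = (i, \<rho>)" using conn[OF a 1(2)] W by (simp add: pos_def)
      then show ?thesis using inU(1)[OF i(1) 1] A(1)[OF Z(1)[OF i(1)]] by blast
    next
      case 2
      then have v: "v \<in> A i" using S1[OF i(1)] by blast
      moreover have "v \<notin> W" using 2 W_S[OF _ i(1)] by blast
      ultimately show ?thesis
        using 2 cell[OF i(1) v] A_P[OF i(1) v] A(1)[OF i(1)] by (auto simp only: pos_def if_True if_False)
    next
      case 3
      then have v: "v \<in> A i" "v \<notin> W" "v \<notin> S1 i" "v \<notin> S2 i" by (auto simp: R_def)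
      then show ?thesis
        using 3 cell[OF i(1) v(1)] A_P[OF i(1) v(1)] A(1)[OF i(1)] by (auto simp only: pos_def if_True if_False)
    next
      case 4
      then have v: "v \<in> A i" using S2[OF i(1)] by blast
      moreover have "v \<notin> W" "v \<notin> S1 i" using 4 W_S[OF _ i(1)] S12[OF i(1)] by blast+
      ultimately show ?thesis
        using 4 cell[OF i(1) v] A_P[OF i(1) v] A(1)[OF i(1)] by (auto simp only: pos_def if_True if_False)
    qed
    then show "pos v = (i, \<rho>)" "v \<in> V" by auto
  qed

  \<comment> \<open>Adjacency within blocks and between consecutive blocks\<close>
  have clique': "{u, v} \<in> E" if "i < q" "u \<in> A i" "v \<in> A i" "u \<noteq> v" for i u v
    using clique that by blast
  have HE: "{u, v} \<in> E" if "{u, v} \<in> H \<or> {v, u} \<in> H" for u v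
    using that \<open>H \<subseteq> E\<close> by (auto simp: insert_commute)
  have sub0: "B (i, \<rho>) \<subseteq> A i" if "i < q" "\<rho> \<le> 2" for i \<rho>
    using that S1[OF that(1)] S2[OF that(1)] by (auto simp: B_def R_def)
  have same: "{u, v} \<in> E" if i: "i < q" "\<rho> < 8" and uv: "u \<in> B (i, \<rho>)" "v \<in> B (i, \<rho>)" "u \<noteq> v"
    for i \<rho> u v
  proof (cases "\<rho> \<le> 2")
    case True
    then show ?thesis using clique'[OF i(1)] sub0[OF i(1)] uv by blast
  next
    case False
    then have r: "\<rho> \<in> {3..7}" using i by auto
    have U': "{u, v} \<in> E" if "u \<in> U (i, \<rho>)" "v \<in> U (i, \<rho>)"
      using clique'[OF Z(1)[OF i(1)]] inU(1)[OF i(1) r] that uv(3) by blast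
    show ?thesis
    \<comment> \<open>\<open>P i\<close> has at most one element, so of two distinct vertices at
      position 5 at least one lies in \<open>U (i, 5)\<close>, all of whose members are adjacent to
      \<open>P i\<close>.\<close>
    proof (cases "\<rho> = 5")
      case True
      then have "u \<in> P i \<or> u \<in> U (i, \<rho>)" "v \<in> P i \<or> v \<in> U (i, \<rho>)" "T i \<rho> = P i"
        using uv by (auto simp: B_def T_def)
      then show ?thesis using U' HE inU(4)[OF i(1) r] P(1)[OF i(1)] uv(3) by metis
    next
      case False
      then show ?thesis using U' uv r by (auto simp: B_def)
    qed
  qed
  have step: "{u, v} \<in> E"
    if i: "i < q" "\<rho> < 7" and uv: "u \<in> B (i, \<rho>)" "v \<in> B (i, Suc \<rho>)" "u \<noteq> v" for i \<rho> u v
  proof -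
    have AZ: "{u, v} \<in> E" if "u \<in> U (i, \<rho>)" "v \<in> U (i, Suc \<rho>)" "3 \<le> \<rho>"
    proof -
      have "u \<in> A (Z i)" "v \<in> A (Z i)"
        using inU(1)[OF i(1) _ that(1)] inU(1)[OF i(1) _ that(2)] that(3) i(2) by simp_all
      then show ?thesis using clique'[OF Z(1)[OF i(1)]] uv(3) by blast
    qed
    consider "\<rho> \<le> 1" | "\<rho> = 2" | "\<rho> = 3 \<or> \<rho> = 6" | "\<rho> = 4" | "\<rho> = 5" using i(2) by linarith
    then show ?thesis
    proof cases
      case 1
      then have "u \<in> A i" "v \<in> A i" using sub0[OF i(1), of \<rho>] sub0[OF i(1), of "Suc \<rho>"] uv by auto
      then show ?thesis using clique'[OF i(1)] uv by blast
    next
      case 2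
      then show ?thesis using HE inU(4)[OF i(1), of 3 v u] uv by (simp add: B_def T_def)
    next
      case 3
      then have "u \<in> U (i, \<rho>)" "v \<in> U (i, Suc \<rho>)" "3 \<le> \<rho>" using uv by (auto simp: B_def)
      then show ?thesis by (rule AZ)
    next
      case 4
      then have "v \<in> P i \<or> v \<in> U (i, Suc \<rho>)" "u \<in> U (i, \<rho>)" "T i \<rho> = P i"
        using uv by (auto simp: B_def T_def)
      moreover have "\<rho> \<in> {3..7}" "3 \<le> \<rho>" using 4 by auto
      ultimately show ?thesis using AZ HE inU(4)[OF i(1), of \<rho> u v] by metis
    next
      case 5
      then have "u \<in> P i \<or> u \<in> U (i, \<rho>)" "v \<in> U (i, Suc \<rho>)" "T i (Suc \<rho>) = P i"
        using uv by (auto simp: B_def T_def)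
      moreover have "Suc \<rho> \<in> {3..7}" "3 \<le> \<rho>" using 5 by auto
      ultimately show ?thesis using AZ HE inU(4)[OF i(1), of "Suc \<rho>" v u] by metis
    qed
  qed
  have wrap: "{u, v} \<in> E" if i: "i < q" and uv: "u \<in> B (i, 7)" "v \<in> B (Suc i mod q, 0)" for i u v
    using HE inU(4)[OF i, of 7 u v] uv by (simp add: B_def T_def)

  show ?thesis
  proof (rule contains_hamilton_cycle_power_blocks
      [where Q = "8 * q" and blk = "\<lambda>v. 8 * fst (pos v) + snd (pos v)"])
    fix v assume "v \<in> V"
    then show "8 * fst (pos v) + snd (pos v) < 8 * q" using pos_range[of v] by linarith
  next
    fix b assume "b < 8 * q"
    define i \<rho> where "i = b div 8" and "\<rho> = b mod 8"
    have i: "i < q" "\<rho> < 8" "b = 8 * i + \<rho>"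
      using \<open>b < 8 * q\<close> by (auto simp: i_def \<rho>_def)
    define D where "D = (if \<rho> = 5 then U (i, \<rho>) else B (i, \<rho>))"
    have "k \<le> card D"
    proof (cases "\<rho> \<le> 2")
      case True
      then show ?thesis using S1[OF i(1)] S2[OF i(1)] card_R[OF i(1)] by (auto simp: D_def B_def)
    next
      case False
      then show ?thesis using i U(1)[of "(i, \<rho>)"] by (auto simp: D_def B_def Q_def)
    qed
    also have "card D \<le> card {v \<in> V. 8 * fst (pos v) + snd (pos v) = b}"
    proof (rule card_mono)
      show "D \<subseteq> {v \<in> V. 8 * fst (pos v) + snd (pos v) = b}"
        using pos_core[OF i(1,2)] unfolding D_def i(3) by force
    qed (use \<open>finite V\<close> in simp)
    finally show "k \<le> card {v \<in> V. 8 * fst (pos v) + snd (pos v) = b}" .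
  next
    fix u v assume uv: "u \<in> V" "v \<in> V" "u \<noteq> v"
      and b: "8 * fst (pos v) + snd (pos v) = 8 * fst (pos u) + snd (pos u) \<or>
       8 * fst (pos v) + snd (pos v) = Suc (8 * fst (pos u) + snd (pos u)) mod (8 * q)"
    obtain i \<rho> where i: "pos u = (i, \<rho>)" by force
    obtain j \<sigma> where j: "pos v = (j, \<sigma>)" by force
    have ir: "i < q" "\<rho> < 8" "u \<in> B (i, \<rho>)" using pos_range[OF uv(1)] i by auto
    have jr: "j < q" "\<sigma> < 8" "v \<in> B (j, \<sigma>)" using pos_range[OF uv(2)] j by auto
    consider "8 * j + \<sigma> = 8 * i + \<rho>" | "8 * j + \<sigma> = Suc (8 * i + \<rho>) mod (8 * q)"
      using b i j by auto
    then show "{u, v} \<in> E"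
    proof cases
      case 1
      then have "j = i \<and> \<sigma> = \<rho>" using ir(2) jr(2) by presburger
      then show ?thesis using same ir jr uv by blast
    next
      case 2
      show ?thesis
      proof (cases "\<rho> < 7")
        case True
        then have "8 * j + \<sigma> = Suc (8 * i + \<rho>)" using 2 ir(1) by simp
        then have "j = i \<and> \<sigma> = Suc \<rho>" using True jr(2) by presburger
        then show ?thesis using step True ir jr uv by blast
      next
        case False
        then have \<rho>: "\<rho> = 7" using ir(2) by simp
        then have "8 * j + \<sigma> = (8 * Suc i) mod (8 * q)" using 2 by simp
        also have "\<dots> = 8 * (Suc i mod q)" by (rule mult_mod_right[symmetric])
        finally have eq: "8 * j + \<sigma> = 8 * (Suc i mod q)" .
        have "j = l \<and> \<sigma> = 0" if "8 * j + \<sigma> = 8 * l" for l using that jr(2) by presburger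
        from this[OF eq] have "j = Suc i mod q \<and> \<sigma> = 0" .
        then show ?thesis using wrap ir jr \<rho> by blast
      qed
    qed
  qed (use \<open>finite V\<close> \<open>1 \<le> k\<close> \<open>0 < q\<close> in auto)
qed

text \<open>The deterministic core: the geometry enters through \<open>clique\<close> and the
  randomness through \<open>spread\<close>. In the factor \<open>g + 6\<close>, the part
  \<open>g\<close> keeps the number of vertices in sparse cells below the number of populous cells,
  and the part \<open>6\<close> lets three exceptional sets of cells cover at most half of all
  cells. In \<open>g\<close>, the part \<open>2 * t\<close> provides two disjoint
  \<open>t\<close>-sets per cell, and \<open>13 * k\<close> meets the demands on cells and
  connectors.\<close>

lemma contains_hamilton_cycle_power_cells:
  fixes \<alpha> :: real and c :: "'j \<Rightarrow> 'v set"
  assumes "finite V" "H \<subseteq> E" and k: "1 \<le> k" and \<alpha>: "0 < \<alpha>" "\<alpha> < 1"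
    and deg: "\<And>v. v \<in> V \<Longrightarrow> \<alpha> * card V \<le> card (common_nbrs V H {v})"
    and t: "2 * k \<le> \<alpha> * t" and g: "g = 2 * t + 13 * k"
    and J: "finite J" "J \<noteq> {}" "disjoint_family_on c J" "V = (\<Union>j\<in>J. c j)"
    and clique: "\<And>j u v. \<lbrakk>j \<in> J; u \<in> c j; v \<in> c j; u \<noteq> v\<rbrakk> \<Longrightarrow> {u, v} \<in> E"
    and spread: "\<And>T. \<lbrakk>T \<subseteq> V; card T \<le> k; \<alpha> / 2 / 2 ^ t * card V \<le> card (common_nbrs V H T)\<rbrakk>
        \<Longrightarrow> (g + 6) * card {j \<in> J. card (c j \<inter> common_nbrs V H T) < g} \<le> card J"
  shows "contains_hamilton_cycle_power k V E"
proof -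
  define few where "few T = {j \<in> J. card (c j \<inter> common_nbrs V H T) < g}" for T
  define good where "good = {j \<in> J. g \<le> card (c j)}"
  define q where "q = card good"
  have fin: "finite good" "\<And>T. finite (few T)" using J(1) by (auto simp: good_def few_def)
  have cV: "c j \<subseteq> V" if "j \<in> J" for j using that J(4) by blast
  have finc: "finite (c j)" if "j \<in> J" for j using cV[OF that] \<open>finite V\<close> finite_subset by blast
  have \<beta>: "\<alpha> / 2 / 2 ^ t \<le> \<alpha>" "\<alpha> / 2 / 2 ^ t \<le> 1"
  proof -
    have "\<alpha> / (2 * 2 ^ t) \<le> \<alpha> / 1" using \<alpha> one_le_power[of "2::real" t]
      by (intro divide_left_mono) linarith+
    then show "\<alpha> / 2 / 2 ^ t \<le> \<alpha>" by simp
    then show "\<alpha> / 2 / 2 ^ t \<le> 1" using \<alpha> by linarith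
  qed
  \<comment> \<open>Sets with at most one element always satisfy the threshold of
    \<open>spread\<close>: the empty set trivially, a singleton by the minimum degree.\<close>
  have spread_small: "(g + 6) * card (few T) \<le> card J" 
    if TV: "T \<subseteq> V" and uniq: "\<And>u v. u \<in> T \<Longrightarrow> v \<in> T \<Longrightarrow> u = v" for T
  proof (cases "T = {}")
    case True
    have "\<alpha> / 2 / 2 ^ t * card V \<le> 1 * real (card V)" using \<beta> by (intro mult_right_mono) auto
    then show ?thesis using spread[of "{}"] True by (simp add: few_def)
  next
    case False
    then obtain v where T: "T = {v}" using uniq by blast
    have "\<alpha> / 2 / 2 ^ t * card V \<le> \<alpha> * card V" using \<beta> by (intro mult_right_mono) auto
    then show ?thesis using spread[of "{v}"] deg[of v] T TV k by (simp add: few_def)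
  qed
  have compl: "few {} = J - good"
  proof -
    have "c j \<inter> V = c j" if "j \<in> J" for j using cV[OF that] by blast
    then show ?thesis by (auto simp: few_def good_def not_le)
  qed
  have q_eq: "card J = q + card (few {})"
  proof -
    have "good \<subseteq> J" by (auto simp: good_def)
    then show ?thesis
      unfolding q_def compl using J(1) fin(1) card_mono[OF J(1)] by (simp add: card_Diff_subset)
  qed
  have s0: "(g + 6) * card (few {}) \<le> card J" using spread_small[of "{}"] by simp
  have q0: "0 < q"
  proof (rule ccontr)
    assume "\<not> 0 < q"
    then have "6 * card J \<le> card J" using q_eq s0 by (simp add: algebra_simps)
    then show False using J(1,2) by simp
  qed
  obtain h where h: "bij_betw h {..<q} good"
    using ex_bij_betw_nat_finite[OF fin(1)] by (auto simp: q_def atLeast0LessThan)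
  define A where "A i = c (h i)" for i
  have hJ: "h i \<in> J" "g \<le> card (A i)" if "i < q" for i
    using h that by (auto simp: A_def good_def bij_betw_def)
  have A_dis: "disjoint_family_on A {..<q}"
    unfolding disjoint_family_on_def
  proof (intro ballI impI)
    fix i j assume "i \<in> {..<q}" "j \<in> {..<q}" "i \<noteq> j"
    then have "h i \<noteq> h j" "h i \<in> J" "h j \<in> J"
      using h hJ by (auto simp: bij_betw_def inj_on_def)
    then show "A i \<inter> A j = {}" using J(3) by (auto simp: A_def disjoint_family_on_def)
  qed

  \<comment> \<open>Distributing the vertices of sparse cells over the rounds\<close>
  define bad where "bad = (\<Union>j\<in>few {}. c j)"
  have "card bad \<le> (\<Sum>j\<in>few {}. card (c j))" unfolding bad_def using fin by (intro card_UN_le)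
  also have "\<dots> \<le> (\<Sum>j\<in>few {}. g)"
    unfolding compl by (intro sum_mono) (auto simp: good_def)
  also have "\<dots> \<le> q" using s0 q_eq by (simp add: algebra_simps)
  finally have "card bad \<le> card {..<q}" by simp
  moreover have "finite bad" unfolding bad_def compl using J(1) finc by auto
  \<comment> \<open>The injection sends each such vertex to a round of its own, so every
    \<open>P i\<close> has at most one element.\<close>
  ultimately obtain f where f: "inj_on f bad" "f ` bad \<subseteq> {..<q}"
    using card_le_inj[of bad "{..<q}"] by auto
  define P where "P i = {v \<in> bad. f v = i}" for i
  have P_uniq: "u = v" if "u \<in> P i" "v \<in> P i" for i u v
    using that f(1) by (auto simp: P_def inj_on_def)
  have P_V: "P i \<subseteq> V" for i using J(4) by (auto simp: P_def bad_def few_def)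
  have P_A: "P i \<inter> A j = {}" if "j < q" for i j
  proof -
    have "h j \<in> good" using h that by (auto simp: bij_betw_def)
    then have "c l \<inter> c (h j) = {}" if "l \<in> few {}" for l
    proof -
      have "l \<in> J" "h j \<in> J" "l \<noteq> h j"
        using that \<open>h j \<in> good\<close> unfolding compl by (auto simp: good_def)
      then show ?thesis using J(3) by (simp add: disjoint_family_on_def)
    qed
    then show ?thesis by (auto simp: P_def bad_def A_def)
  qed
  have V_eq: "V = (\<Union>i<q. A i \<union> P i)"
  proof
    show "(\<Union>i<q. A i \<union> P i) \<subseteq> V" using P_V cV hJ(1) by (fastforce simp: A_def)
    show "V \<subseteq> (\<Union>i<q. A i \<union> P i)"
    proof
      fix v assume "v \<in> V"
      then obtain j where j: "j \<in> J" "v \<in> c j" using J(4) by blast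
      show "v \<in> (\<Union>i<q. A i \<union> P i)"
      proof (cases "j \<in> good")
        case True
        then obtain i where "i < q" "h i = j" using h by (auto simp: bij_betw_def)
        then show ?thesis using j by (auto simp: A_def)
      next
        case False
        then have "v \<in> bad" using j unfolding bad_def compl by blast
        then show ?thesis using f(2) by (auto simp: P_def)
      qed
    qed
  qed

  \<comment> \<open>Entrance and exit sets of the populous cells\<close>
  define big where "big S \<longleftrightarrow> card S = k \<and> \<alpha> / 2 / 2 ^ t * card V \<le> card (common_nbrs V H S)" for S
  have "\<exists>S1 S2. S1 \<subseteq> A i \<and> S2 \<subseteq> A i \<and> S1 \<inter> S2 = {} \<and> big S1 \<and> big S2" if i: "i < q" for i
  proof -
    have AV: "A i \<subseteq> V" "finite (A i)" using cV finc hJ(1)[OF i] by (auto simp: A_def)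
    have "t \<le> card (A i)" using hJ(2)[OF i] g by simp
    then obtain X where X: "X \<subseteq> A i" "card X = t" "finite X"
      using obtain_subset_with_card_n by metis
    then have "t \<le> card (A i - X)" using hJ(2)[OF i] g by (simp add: card_Diff_subset)
    then obtain X' where X': "X' \<subseteq> A i - X" "card X' = t"
      using obtain_subset_with_card_n by metis
    obtain S1 where S1: "S1 \<subseteq> X" "big S1"
      using exists_subset_many_common_nbrs[OF \<open>finite V\<close> deg, where A = X and t = t and k = k] X AV k t \<alpha>
      unfolding big_def by auto
    obtain S2 where S2: "S2 \<subseteq> X'" "big S2"
      using exists_subset_many_common_nbrs[OF \<open>finite V\<close> deg, where A = X' and t = t and k = k] X' AV k t \<alpha>
      unfolding big_def by auto
    have "S1 \<subseteq> A i" "S2 \<subseteq> A i" "S1 \<inter> S2 = {}" using S1(1) S2(1) X(1) X'(1) by auto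
    then show ?thesis using S1(2) S2(2) by (intro exI conjI)
  qed
  then obtain S1 S2 where S: "\<And>i. i < q \<Longrightarrow>
      S1 i \<subseteq> A i \<and> S2 i \<subseteq> A i \<and> S1 i \<inter> S2 i = {} \<and> big (S1 i) \<and> big (S2 i)"
    by metis
  have spread_big: "(g + 6) * card (few T) \<le> card J" if "T \<subseteq> A i" "i < q" "big T" for T i
    using spread[of T] that cV[OF hJ(1)[OF that(2)]] unfolding big_def few_def A_def by auto

  \<comment> \<open>Choosing the connector cells\<close>
  define F where "F i = {l \<in> {..<q}. g \<le> card (A l \<inter> common_nbrs V H (S2 i)) \<and>
      g \<le> card (A l \<inter> common_nbrs V H (P i)) \<and>
      g \<le> card (A l \<inter> common_nbrs V H (S1 (Suc i mod q)))}" for i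
  have "\<exists>Z. (\<forall>i\<in>{..<q}. Z i \<in> F i) \<and> (\<forall>j. card {i \<in> {..<q}. Z i = j} \<le> 2)"
  proof (rule exists_assignment_load_le)
    fix i assume "i \<in> {..<q}"
    then have i: "i < q" "Suc i mod q < q" using q0 by auto
    define X where "X = few (S2 i) \<union> few (P i) \<union> few (S1 (Suc i mod q))"
    have s: "6 * card (few (S2 i)) \<le> card J" "6 * card (few (P i)) \<le> card J"
      "6 * card (few (S1 (Suc i mod q))) \<le> card J"
      using spread_big[of "S2 i" i] spread_big[of "S1 (Suc i mod q)" "Suc i mod q"]
        spread_small[OF P_V, of i] P_uniq S i
      by (auto simp: algebra_simps)
    have "card X \<le> card (few (S2 i)) + card (few (P i)) + card (few (S1 (Suc i mod q)))"
      unfolding X_def by (meson add_le_mono1 card_Un_le le_trans)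
    then have X: "2 * card X \<le> card J" using s by linarith
    \<comment> \<open>A cell outside \<open>X\<close> already contains \<open>g\<close> common
      neighbours, so it is populous and has an index below \<open>q\<close>. Hence at least half of
      \<open>card J\<close>, and so at least \<open>q / 2\<close>, cells are admissible; this is the
      source of the load bound 2.\<close>
    have "J - X \<subseteq> h ` F i"
    proof
      fix j assume j: "j \<in> J - X"
      then have *: "g \<le> card (c j \<inter> common_nbrs V H (S2 i))" "g \<le> card (c j \<inter> common_nbrs V H (P i))"
        "g \<le> card (c j \<inter> common_nbrs V H (S1 (Suc i mod q)))"
        by (auto simp: X_def few_def not_less)
      have "card (c j \<inter> common_nbrs V H (S2 i)) \<le> card (c j)"
        using finc j by (intro card_mono) auto
      then have "j \<in> good" using * j by (auto simp: good_def)
      then obtain l where "l < q" "h l = j" using h by (auto simp: bij_betw_def)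
      then show "j \<in> h ` F i" using * by (auto simp: F_def A_def)
    qed
    then have "card (J - X) \<le> card (F i)" by (rule surj_card_le[rotated]) (simp add: F_def)
    moreover have "card J - card X \<le> card (J - X)"
      by (rule diff_card_le_card_Diff) (simp add: X_def fin)
    ultimately have "card J \<le> 2 * card (F i)" using X by linarith
    then show "finite (F i) \<and> card {..<q} \<le> 2 * card (F i)"
      using q_eq by (simp add: F_def)
  qed simp
  then obtain Z where Z: "\<And>i. i < q \<Longrightarrow> Z i \<in> F i" "\<And>j. card {i \<in> {..<q}. Z i = j} \<le> 2" by auto

  show ?thesis
  proof (rule contains_hamilton_cycle_power_connectors[of V k q H E A S1 S2 P Z])
    show "disjoint_family_on P {..<q}" by (auto simp: disjoint_family_on_def P_def)
    show "A i \<subseteq> V" if "i < q" for i using cV hJ(1)[OF that] by (auto simp: A_def)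
    show "13 * k \<le> card (A i)" if "i < q" for i using hJ(2)[OF that] g by simp
    show "{u, v} \<in> E" if "i < q" "u \<in> A i" "v \<in> A i" "u \<noteq> v" for i u v
      using clique[OF hJ(1)] that by (auto simp: A_def)
    show "12 * k \<le> card (A (Z i) \<inter> common_nbrs V H (S2 i))"
      "12 * k \<le> card (A (Z i) \<inter> common_nbrs V H (P i))"
      "12 * k \<le> card (A (Z i) \<inter> common_nbrs V H (S1 (Suc i mod q)))" if "i < q" for i
      using Z(1)[OF that] g by (auto simp: F_def)
    show "Z i < q" if "i < q" for i using Z(1)[OF that] by (simp add: F_def)
  qed (use \<open>finite V\<close> k q0 \<open>H \<subseteq> E\<close> A_dis S P_uniq P_A V_eq Z(2) in \<open>auto simp: big_def\<close>)
qed

section \<open>Random points in cells\<close>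

lemma product_few_points:
  fixes U :: "'a measure" and a :: nat
  assumes "prob_space U" "finite I" "S \<subseteq> I" and D: "D \<in> sets U"
  defines "F \<equiv> {X \<in> space (Pi\<^sub>M I (\<lambda>_. U)). card {i \<in> S. X i \<in> D} \<le> a}"
  shows "F \<in> sets (Pi\<^sub>M I (\<lambda>_. U))"
    and "measure (Pi\<^sub>M I (\<lambda>_. U)) F \<le> 2 ^ a * (1 - measure U D / 2) ^ card S"
proof -
  interpret U: prob_space U by fact
  interpret product_prob_space "\<lambda>_. U" ..
  let ?M = "Pi\<^sub>M I (\<lambda>_. U)"
  interpret M: prob_space ?M by (rule prob_space_PiM) (rule \<open>prob_space U\<close>)
  \<comment> \<open>Every point of \<open>S\<close> falling into \<open>D\<close> halves the
    product; indices outside \<open>S\<close> get weight 1, so the product runs over all of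
    \<open>I\<close> and independence turns its expectation into a product of expectations.\<close>
  define h :: "_ \<Rightarrow> 'a \<Rightarrow> real" where "h i x = (if i \<in> S \<and> x \<in> D then 1 / 2 else 1)" for i x
  define f where "f X = (\<Prod>i\<in>I. h i (X i))" for X
  have f_eq: "f X = (1 / 2) ^ card {i \<in> S. X i \<in> D}" for X
  proof -
    have "f X = (\<Prod>i\<in>{i \<in> I. i \<in> S \<and> X i \<in> D}. 1 / 2)"
      using \<open>finite I\<close> by (simp add: f_def h_def prod.If_cases Int_def)
    also have "{i \<in> I. i \<in> S \<and> X i \<in> D} = {i \<in> S. X i \<in> D}" using \<open>S \<subseteq> I\<close> by auto
    finally show ?thesis by simp
  qed
  have h_alt: "h i = (\<lambda>x. 1 - (if i \<in> S then indicator D x / 2 else 0))" for i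
    by (auto simp: h_def fun_eq_iff)
  have h_int: "integrable U (h i)" for i
    unfolding h_alt using D
    by (cases "i \<in> S") (auto intro!: Bochner_Integration.integrable_diff simp: less_top[symmetric])
  have h_val: "(\<integral>x. h i x \<partial>U) = (if i \<in> S then 1 - measure U D / 2 else 1)" for i
    unfolding h_alt using D
    by (cases "i \<in> S") (auto simp: U.prob_space Bochner_Integration.integral_diff less_top[symmetric])
  have f_int: "integrable ?M f"
    unfolding f_def by (rule product_integrable_prod[OF \<open>finite I\<close> h_int])
  have "(\<integral>X. f X \<partial>?M) = (\<Prod>i\<in>I. \<integral>x. h i x \<partial>U)"
    unfolding f_def by (rule product_integral_prod[OF \<open>finite I\<close> h_int])
  also have "\<dots> = (1 - measure U D / 2) ^ card S"
    using \<open>finite I\<close> \<open>S \<subseteq> I\<close> by (simp add: h_val prod.If_cases Int_absorb1)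
  finally have f_val: "(\<integral>X. f X \<partial>?M) = (1 - measure U D / 2) ^ card S" .
  \<comment> \<open>Chernoff: Markov's inequality for \<open>2 ^ - (number of points in D)\<close>\<close>
  have F_eq: "F = {X \<in> space ?M. (1 / 2) ^ a \<le> f X}"
    unfolding F_def f_eq by (simp add: power_decreasing_iff)
  show "F \<in> sets ?M" unfolding F_eq using f_int by measurable
  have "measure ?M F \<le> (\<integral>X. f X \<partial>?M) / (1 / 2) ^ a"
    unfolding F_eq
    by (rule integral_Markov_inequality_measure[OF f_int sets.empty_sets]) (auto simp: f_eq)
  then show "measure ?M F \<le> 2 ^ a * (1 - measure U D / 2) ^ card S"
    by (simp add: f_val power_divide mult.commute)
qed

text \<open>If too many cells were sparse, their union would be a large region containing at most
  \<open>g\<close> points per cell on average. A union bound over the at most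
  \<open>2 ^ card J\<close> sets of cells is affordable, since each is exceptional with probability
  at most \<open>exp (- 2 * card J)\<close>.\<close>

lemma product_few_sparse_cells:
  fixes U :: "'a measure" and B :: "'j \<Rightarrow> 'a set" and g w :: nat
  assumes "prob_space U" "finite I" "S \<subseteq> I"
    and J: "finite J" "J \<noteq> {}" "disjoint_family_on B J"
    and B: "\<And>j. j \<in> J \<Longrightarrow> B j \<in> sets U \<and> measure U (B j) = 1 / card J"
    and S: "2 * card J * (g + 2 * w) \<le> card S"
  shows "\<exists>F\<in>sets (Pi\<^sub>M I (\<lambda>_. U)). measure (Pi\<^sub>M I (\<lambda>_. U)) F \<le> exp (- real (card J)) \<and>
    (\<forall>X\<in>space (Pi\<^sub>M I (\<lambda>_. U)) - F. w * card {j \<in> J. card {i \<in> S. X i \<in> B j} < g} \<le> card J)"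
proof -
  interpret U: prob_space U by fact
  let ?M = "Pi\<^sub>M I (\<lambda>_. U)"
  interpret M: prob_space ?M by (rule prob_space_PiM) (rule \<open>prob_space U\<close>)
  define m where "m = card J"
  have m: "0 < m" using J by (simp add: m_def card_gt_0_iff)
  define \<D> where "\<D> = {D. D \<subseteq> J \<and> m < w * card D}"
  have fin\<D>: "finite \<D>" "card \<D> \<le> 2 ^ m"
  proof -
    have "\<D> \<subseteq> Pow J" by (auto simp: \<D>_def)
    then show "finite \<D>" "card \<D> \<le> 2 ^ m"
      using J(1) card_mono[of "Pow J" \<D>] finite_subset[of \<D> "Pow J"]
      by (auto simp: card_Pow m_def)
  qed
  define F where "F D = {X \<in> space ?M. card {i \<in> S. X i \<in> (\<Union>j\<in>D. B j)} \<le> g * card D}" for D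
  have F: "F D \<in> sets ?M" "measure ?M (F D) \<le> exp (- 2 * real m)" if D: "D \<in> \<D>" for D
  proof -
    define e where "e = card D"
    have DJ: "D \<subseteq> J" "finite D" using D J(1) finite_subset by (auto simp: \<D>_def)
    have sets: "(\<Union>j\<in>D. B j) \<in> sets U" using B DJ by auto
    show "F D \<in> sets ?M" unfolding F_def by (rule product_few_points[OF assms(1-3) sets])
    have "measure U (\<Union>j\<in>D. B j) = (\<Sum>j\<in>D. measure U (B j))"
      using DJ B J(3) by (intro U.finite_measure_finite_Union)
        (auto intro: disjoint_family_on_mono)
    also have "\<dots> = (\<Sum>j\<in>D. 1 / m)" using B DJ by (intro sum.cong) (auto simp: m_def)
    also have "\<dots> = e / m" by (simp add: e_def)
    finally have p: "measure U (\<Union>j\<in>D. B j) = e / m" .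
    have em: "e / m \<le> 1" using U.prob_le_1[of "\<Union>j\<in>D. B j"] p by simp
    have "measure ?M (F D) \<le> 2 ^ (g * e) * (1 - e / m / 2) ^ card S"
      unfolding F_def using product_few_points(2)[OF assms(1-3) sets] by (simp add: p e_def)
    also have "\<dots> \<le> exp (g * e) * exp (- (e / m / 2) * card S)"
    proof (intro mult_mono)
      have "(2::real) ^ (g * e) \<le> exp 1 ^ (g * e)"
        using exp_ge_add_one_self[of 1] by (intro power_mono) auto
      then show "(2::real) ^ (g * e) \<le> exp (g * e)" 
        by (simp flip: exp_of_nat_mult)
      have "(1 - e / m / 2) ^ card S \<le> exp (- (e / m / 2)) ^ card S"
        using exp_ge_add_one_self[of "- (e / m / 2)"] em by (intro power_mono) auto
      then show "(1 - e / m / 2) ^ card S \<le> exp (- (e / m / 2) * card S)"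
        by (simp add: exp_of_nat_mult[symmetric] mult.commute)
    qed (use em in auto)
    also have "\<dots> = exp (g * e - (e / m / 2) * card S)" by (simp add: exp_add[symmetric])
    \<comment> \<open>By the size of \<open>S\<close> the exponent is at most
      \<open>g * e - e * (g + 2 * w) = - 2 * w * e\<close>, and \<open>w * e\<close> exceeds
      \<open>m\<close> by the choice of \<open>\<D>\<close>.\<close>
    also have "\<dots> \<le> exp (- 2 * real m)"
    proof -
      have "real (2 * m * (g + 2 * w)) \<le> real (card S)" using S unfolding m_def of_nat_le_iff .
      then have "(e / m / 2) * (2 * real m * (g + 2 * w)) \<le> (e / m / 2) * card S"
        by (intro mult_left_mono) auto
      moreover have "(e / m / 2) * (2 * real m * (g + 2 * w)) = e * (real g + 2 * w)"
        using m by (simp add: field_simps)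
      moreover have "real m \<le> w * e" using D by (simp add: \<D>_def e_def flip: of_nat_mult)
      ultimately show ?thesis by (simp add: algebra_simps)
    qed
    finally show "measure ?M (F D) \<le> exp (- 2 * real m)" .
  qed
  show ?thesis
  proof (intro bexI conjI ballI)
    show sets: "(\<Union>D\<in>\<D>. F D) \<in> sets ?M" using F(1) fin\<D>(1) by auto
    have "measure ?M (\<Union>D\<in>\<D>. F D) \<le> (\<Sum>D\<in>\<D>. measure ?M (F D))"
      using F(1) fin\<D>(1) by (intro M.finite_measure_subadditive_finite) auto
    also have "\<dots> \<le> card \<D> * exp (- 2 * real m)"
      using F(2) by (intro sum_bounded_above) auto
    also have "\<dots> \<le> exp m * exp (- 2 * real m)"
    proof (intro mult_right_mono)
      have "real (card \<D>) \<le> 2 ^ m" using fin\<D>(2) by (simp flip: of_nat_le_iff)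
      also have "(2::real) ^ m \<le> exp 1 ^ m"
        using exp_ge_add_one_self[of 1] by (intro power_mono) auto
      also have "\<dots> = exp m" by (simp flip: exp_of_nat_mult)
      finally show "real (card \<D>) \<le> exp m" .
    qed simp
    also have "\<dots> = exp (- real (card J))" by (simp add: exp_add[symmetric] m_def)
    finally show "measure ?M (\<Union>D\<in>\<D>. F D) \<le> exp (- real (card J))" .
    fix X assume X: "X \<in> space ?M - (\<Union>D\<in>\<D>. F D)"
    define D where "D = {j \<in> J. card {i \<in> S. X i \<in> B j} < g}"
    have "card {i \<in> S. X i \<in> (\<Union>j\<in>D. B j)} = card (\<Union>j\<in>D. {i \<in> S. X i \<in> B j})"
      by (rule arg_cong[where f = card]) auto
    also have "\<dots> \<le> (\<Sum>j\<in>D. card {i \<in> S. X i \<in> B j})"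
      using J(1) by (intro card_UN_le) (simp add: D_def)
    also have "\<dots> \<le> (\<Sum>j\<in>D. g)" by (intro sum_mono) (auto simp: D_def)
    finally have "X \<in> F D" using X by (simp add: F_def mult.commute)
    then have "D \<notin> \<D>" using X by blast
    then show "w * card {j \<in> J. card {i \<in> S. X i \<in> B j} < g} \<le> card J"
      unfolding \<D>_def D_def m_def by auto
  qed
qed

text \<open>A set of at most \<open>k\<close> elements is the result of \<open>k\<close> draws from
  \<open>V\<close>, each of which may be blank (\<open>None\<close>), so every draw has
  \<open>card V + 1\<close> outcomes.\<close>

lemma card_subsets_card_le:
  assumes "finite V"
  shows "card {T. T \<subseteq> V \<and> card T \<le> k} \<le> (card V + 1) ^ k"
proof (induction k)
  case 0
  have "{T. T \<subseteq> V \<and> card T \<le> 0} = {{}}" using assms finite_subset by fastforce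
  then show ?case by simp
next
  case (Suc k)
  let ?\<T> = "\<lambda>k. {T. T \<subseteq> V \<and> card T \<le> k}"
  let ?f = "\<lambda>(x, T). case x of None \<Rightarrow> T | Some v \<Rightarrow> insert v T"
  have fin: "finite (?\<T> k)" using assms by simp
  have "?\<T> (Suc k) \<subseteq> ?f ` (insert None (Some ` V) \<times> ?\<T> k)"
  proof
    fix T assume T: "T \<in> ?\<T> (Suc k)"
    show "T \<in> ?f ` (insert None (Some ` V) \<times> ?\<T> k)"
    proof (cases "T = {}")
      case True
      then show ?thesis by (intro image_eqI[of _ _ "(None, {})"]) auto
    next
      case False
      then obtain v where v: "v \<in> T" by blast
      then have "card (T - {v}) \<le> k" using T by auto
      then show ?thesis using v T by (intro image_eqI[of _ _ "(Some v, T - {v})"]) auto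
    qed
  qed
  then have "card (?\<T> (Suc k)) \<le> card (insert None (Some ` V) \<times> ?\<T> k)"
    using assms fin by (intro surj_card_le) auto
  also have "\<dots> = (card V + 1) * card (?\<T> k)"
    using assms by (simp add: card_cartesian_product card_image)
  also have "\<dots> \<le> (card V + 1) * (card V + 1) ^ k" using Suc.IH by (rule mult_le_mono2)
  finally show ?case by simp
qed

text \<open>There are finitely many graphs on \<open>{1..n}\<close>, so any event about the graph is
  a finite union of events fixing the whole edge set, and those depend on finitely many comparisons
  of distances.\<close>

lemma sets_geometric_edges:
  "{X \<in> space (random_points n :: (nat \<Rightarrow> real ^ 'd::finite) measure). Q (geometric_edges n r X)}
     \<in> sets (random_points n)"
proof -
  let ?M = "random_points n :: (nat \<Rightarrow> real ^ 'd) measure"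
  have "{X \<in> space ?M. Q (geometric_edges n r X)} =
      (\<Union>G\<in>{G \<in> Pow (Pow {1..n}). Q G}. {X \<in> space ?M. \<forall>e\<in>Pow {1..n}. e \<in> geometric_edges n r X \<longleftrightarrow> e \<in> G})"
    (is "?L = ?R")
  proof -
    have sub: "geometric_edges n r X \<subseteq> Pow {1..n}" for X :: "nat \<Rightarrow> real ^ 'd"
      by (auto simp: geometric_edges_def)
    show ?thesis
    proof
      show "?L \<subseteq> ?R" using sub by blast
      show "?R \<subseteq> ?L"
      proof
        fix X assume "X \<in> ?R"
        then obtain G where G: "G \<subseteq> Pow {1..n}" "Q G" "X \<in> space ?M"
          "\<forall>e\<in>Pow {1..n}. e \<in> geometric_edges n r X \<longleftrightarrow> e \<in> G" by blast
        then have "geometric_edges n r X = G" using sub[of X] by blast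
        then show "X \<in> ?L" using G by simp
      qed
    qed
  qed
  also have "\<dots> \<in> sets ?M"
  proof (rule sets.finite_UN)
    fix G
    have "{X \<in> space ?M. e \<in> geometric_edges n r X} \<in> sets ?M" for e
    proof -
      have comp: "(\<lambda>X. X i) \<in> borel_measurable ?M" if "i \<in> {1..n}" for i
      proof -
        have "(\<lambda>X. X i) \<in> measurable ?M (uniform_measure lborel (cbox 0 1))"
          unfolding random_points_def using that by (rule measurable_component_singleton)
        then show ?thesis by (simp cong: measurable_cong_sets)
      qed
      have "{X \<in> space ?M. norm (X i - X j) \<le> r} \<in> sets ?M" if "i \<in> {1..n}" "j \<in> {1..n}" for i j
        using comp[OF that(1)] comp[OF that(2)] by measurable
      moreover have "{X \<in> space ?M. e \<in> geometric_edges n r X} =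
          (\<Union>i\<in>{1..n}. \<Union>j\<in>{j \<in> {1..n}. e = {i, j} \<and> i \<noteq> j}. {X \<in> space ?M. norm (X i - X j) \<le> r})"
        unfolding geometric_edges_def by blast
      ultimately show ?thesis by simp
    qed
    then show "{X \<in> space ?M. \<forall>e\<in>Pow {1..n}. e \<in> geometric_edges n r X \<longleftrightarrow> e \<in> G} \<in> sets ?M"
      by (intro sets.sets_Collect_finite_All sets.sets_Collect) auto
  qed simp
  finally show ?thesis .
qed

section \<open>The grid of cells in the unit cube\<close>

definition grid :: "nat \<Rightarrow> ('d::finite \<Rightarrow> nat) set" where
  "grid m = {z. \<forall>i. z i < m}"

text \<open>Cells are open boxes, so that they are disjoint; the grid hyperplanes form a null set.\<close>

definition grid_cell :: "nat \<Rightarrow> ('d::finite \<Rightarrow> nat) \<Rightarrow> (real ^ 'd) set" where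
  "grid_cell m z = box (\<chi> i. z i / m) (\<chi> i. (real (z i) + 1) / m)"

lemma card_grid: "card (grid m :: ('d::finite \<Rightarrow> nat) set) = m ^ CARD('d)"
  and finite_grid: "finite (grid m :: ('d::finite \<Rightarrow> nat) set)"
proof -
  have "(grid m :: ('d \<Rightarrow> nat) set) = (\<Pi>\<^sub>E i\<in>UNIV. {..<m})"
    by (auto simp: grid_def PiE_def)
  then show "card (grid m :: ('d \<Rightarrow> nat) set) = m ^ CARD('d)"
    and "finite (grid m :: ('d::finite \<Rightarrow> nat) set)"
    by (simp_all add: card_PiE finite_PiE)
qed

lemma mem_grid_cell:
  "x \<in> grid_cell m z \<longleftrightarrow> (\<forall>i. real (z i) / m < x $ i \<and> x $ i < (real (z i) + 1) / m)"
  by (simp add: grid_cell_def mem_box_cart add.commute)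

lemma disjoint_grid_cell:
  assumes "0 < m"
  shows "disjoint_family_on (grid_cell m) (A :: ('d::finite \<Rightarrow> nat) set)"
  unfolding disjoint_family_on_def
proof (intro ballI impI, rule ccontr)
  fix z z' :: "'d \<Rightarrow> nat" assume "z \<noteq> z'" "grid_cell m z \<inter> grid_cell m z' \<noteq> {}"
  then obtain x i where x: "x \<in> grid_cell m z" "x \<in> grid_cell m z'" and i: "z i \<noteq> z' i" by blast
  have "real (z i) < m * x $ i" "m * x $ i < real (z i) + 1"
    "real (z' i) < m * x $ i" "m * x $ i < real (z' i) + 1"
    using x assms by (auto simp: mem_grid_cell field_simps)
  then show False using i by linarith
qed

text \<open>Estimating by the sum of coordinates loses a factor against the Euclidean diameter; this
  only enlarges the final constant \<open>C\<close>.\<close>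

lemma norm_diff_grid_cell_le:
  fixes x y :: "real ^ 'd::finite"
  assumes "x \<in> grid_cell m z" "y \<in> grid_cell m z"
  shows "norm (x - y) \<le> CARD('d) / m"
proof -
  have "norm (x - y) \<le> (\<Sum>i\<in>UNIV. \<bar>(x - y) $ i\<bar>)" by (rule norm_le_l1_cart)
  also have "\<dots> \<le> (\<Sum>i\<in>(UNIV::'d set). 1 / m)"
  proof (rule sum_mono)
    fix i
    have "real (z i) / m < x $ i" "x $ i < real (z i) / m + 1 / m"
      "real (z i) / m < y $ i" "y $ i < real (z i) / m + 1 / m"
      using assms by (auto simp: mem_grid_cell add_divide_distrib)
    then show "\<bar>(x - y) $ i\<bar> \<le> 1 / m" by simp
  qed
  finally show ?thesis by simp
qed

lemma emeasure_lborel_unit_cube: "emeasure lborel (cbox 0 (1 :: real ^ 'd::finite)) = 1"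
proof -
  have "(\<Prod>b\<in>Basis. (1 :: real ^ 'd) \<bullet> b) = 1"
    by (rule prod.neutral) (auto simp: Basis_vec_def inner_axis)
  then show ?thesis
    by (subst emeasure_lborel_cbox) (auto simp: Basis_vec_def inner_axis)
qed

lemma prob_space_unit_cube: "prob_space (uniform_measure lborel (cbox 0 (1 :: real ^ 'd::finite)))"
  by (rule prob_space_uniform_measure) (simp_all add: emeasure_lborel_unit_cube)

lemma measure_grid_cell:
  fixes z :: "'d::finite \<Rightarrow> nat"
  assumes "0 < m" "z \<in> grid m"
  shows "measure (uniform_measure lborel (cbox 0 1)) (grid_cell m z) = 1 / m ^ CARD('d)"
proof -
  have sub: "cbox 0 1 \<inter> grid_cell m z = grid_cell m z"
  proof -
    have "0 \<le> x $ i \<and> x $ i \<le> 1" if "x \<in> grid_cell m z" for x i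
    proof -
      have "real (z i) + 1 \<le> m" using assms(2) of_nat_mono[of "Suc (z i)" m, where 'a = real]
        by (simp add: grid_def Suc_le_eq)
      moreover have "real (z i) < m * x $ i" "m * x $ i < real (z i) + 1"
        using that assms by (auto simp: mem_grid_cell field_simps)
      ultimately have "0 < m * x $ i" "m * x $ i < m * 1" by linarith+
      then show ?thesis using assms by (simp add: zero_less_mult_iff)
    qed
    then show ?thesis by (auto simp: mem_box_cart)
  qed
  have "measure lborel (cbox 0 (1 :: real ^ 'd)) = 1"
    by (simp add: measure_def emeasure_lborel_unit_cube)
  moreover have "measure lborel (grid_cell m z) = 1 / m ^ CARD('d)"
  proof -
    have le: "((\<chi> i. z i / m) :: real ^ 'd) \<bullet> b \<le> (\<chi> i. (real (z i) + 1) / m) \<bullet> b" if "b \<in> Basis" for b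
      using that assms by (auto simp: Basis_vec_def inner_axis field_simps)
    have "measure lborel (grid_cell m z) =
        (\<Prod>b\<in>Basis. ((\<chi> i. (real (z i) + 1) / m) - (\<chi> i. z i / m) :: real ^ 'd) \<bullet> b)"
      unfolding grid_cell_def by (rule measure_lborel_box) (rule le)
    also have "\<dots> = (\<Prod>b\<in>(Basis :: (real ^ 'd) set). 1 / m)"
      by (rule prod.cong) (auto simp: Basis_vec_def inner_axis add_divide_distrib)
    also have "\<dots> = 1 / m ^ CARD('d)" by (simp add: power_one_over)
    finally show ?thesis .
  qed
  moreover have "grid_cell m z \<in> sets lborel" by (simp add: grid_cell_def)
  ultimately show ?thesis
    by (simp add: measure_uniform_measure sub emeasure_lborel_unit_cube)
qed

text \<open>The disjoint cells have total probability 1, so the null set of hyperplanes need not be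
  described.\<close>

lemma AE_grid_cell:
  assumes "0 < m"
  shows "AE x in uniform_measure lborel (cbox 0 (1 :: real ^ 'd::finite)). x \<in> (\<Union>z\<in>grid m. grid_cell m z)"
proof -
  interpret U: prob_space "uniform_measure lborel (cbox 0 (1 :: real ^ 'd))"
    by (rule prob_space_unit_cube)
  have cell: "grid_cell m z \<in> U.events" for z :: "'d \<Rightarrow> nat" by (simp add: grid_cell_def)
  have "U.prob (\<Union>z\<in>grid m. grid_cell m z) = (\<Sum>z\<in>grid m. U.prob (grid_cell m z))"
    using finite_grid cell disjoint_grid_cell[OF assms]
    by (intro U.finite_measure_finite_Union) auto
  also have "\<dots> = (\<Sum>z\<in>(grid m :: ('d \<Rightarrow> nat) set). 1 / m ^ CARD('d))"
    using assms by (intro sum.cong) (auto simp: measure_grid_cell)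
  also have "\<dots> = 1" using assms by (simp add: card_grid)
  finally show ?thesis using cell finite_grid by (subst (asm) U.prob_eq_1) auto
qed

text \<open>A union bound over the sets \<open>T\<close> with large common neighbourhood, applying
  \<open>product_few_sparse_cells\<close> to each neighbourhood with \<open>w = g + 6\<close>; this
  explains \<open>2 * (g + 6)\<close> in \<open>size\<close>. Outside the exceptional event the
  deterministic lemma on cells applies.\<close>

lemma prob_contains_hamilton_cycle_power_ge:
  fixes \<alpha> :: real and k m n t g :: nat
  assumes k: "1 \<le> k" and \<alpha>: "0 < \<alpha>" "\<alpha> < 1"
    and H: "simple_graph {1..n} H" "\<alpha> * n \<le> min_degree {1..n} H"
    and t: "2 * real k \<le> \<alpha> * t" and g: "g = 2 * t + 13 * k"
    and m: "0 < m" "CARD('d::finite) / m \<le> r"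
    and size: "2 * m ^ CARD('d) * (g + 2 * (g + 6)) \<le> \<alpha> / 2 / 2 ^ t * n"
  shows "1 - (n + 1) ^ k * exp (- real (m ^ CARD('d))) \<le>
    measure (random_points n :: (nat \<Rightarrow> real ^ 'd) measure)
      {X \<in> space (random_points n). contains_hamilton_cycle_power k {1..n} (H \<union> geometric_edges n r X)}"
proof -
  let ?V = "{1..n}"
  let ?U = "uniform_measure lborel (cbox 0 (1 :: real ^ 'd))"
  let ?M = "random_points n :: (nat \<Rightarrow> real ^ 'd) measure"
  let ?N = "common_nbrs ?V H"
  let ?J = "grid m :: ('d \<Rightarrow> nat) set"
  have M: "?M = Pi\<^sub>M ?V (\<lambda>_. ?U)" by (simp add: random_points_def)
  interpret U: prob_space ?U by (rule prob_space_unit_cube)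
  interpret product_prob_space "\<lambda>_. ?U" ?V ..
  interpret M: prob_space ?M unfolding M by (rule prob_space_PiM) (rule prob_space_unit_cube)
  have J: "finite ?J" "?J \<noteq> {}" "disjoint_family_on (grid_cell m) ?J"
    using finite_grid disjoint_grid_cell m by (auto simp: grid_def)
  have cJ: "card ?J = m ^ CARD('d)" by (rule card_grid)
  have deg: "\<alpha> * card ?V \<le> card (?N {v})" if "v \<in> ?V" for v
  proof -
    have "min_degree ?V H \<le> vertex_degree H v"
      unfolding min_degree_def using that by (intro Min_le) auto
    then have "real (min_degree ?V H) \<le> card (?N {v})"
      by (simp add: vertex_degree_eq_card_common_nbrs[OF H(1)])
    then show ?thesis using H(2) by simp
  qed
  define \<T> where "\<T> = {T. T \<subseteq> ?V \<and> card T \<le> k \<and> \<alpha> / 2 / 2 ^ t * n \<le> card (?N T)}"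
  have fin\<T>: "finite \<T>" by (rule finite_subset[of _ "Pow ?V"]) (auto simp: \<T>_def)
  have card\<T>: "card \<T> \<le> (n + 1) ^ k"
  proof -
    have "card \<T> \<le> card {T. T \<subseteq> ?V \<and> card T \<le> k}"
      by (intro card_mono) (auto simp: \<T>_def)
    then show ?thesis using card_subsets_card_le[of ?V k] by simp
  qed
  have "\<forall>T\<in>\<T>. \<exists>F. F \<in> sets ?M \<and> measure ?M F \<le> exp (- real (card ?J)) \<and>
      (\<forall>X\<in>space ?M - F. (g + 6) * card {z \<in> ?J. card {i \<in> ?N T. X i \<in> grid_cell m z} < g} \<le> card ?J)"
  proof
    fix T assume T: "T \<in> \<T>"
    have "real (2 * card ?J * (g + 2 * (g + 6))) \<le> real (card (?N T))"
      using size T by (simp add: \<T>_def cJ)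
    then have "2 * card ?J * (g + 2 * (g + 6)) \<le> card (?N T)" unfolding of_nat_le_iff .
    moreover have "grid_cell m z \<in> sets ?U \<and> measure ?U (grid_cell m z) = 1 / card ?J" if "z \<in> ?J" for z
      using measure_grid_cell[OF m(1) that] by (simp add: cJ grid_cell_def)
    ultimately show "\<exists>F. F \<in> sets ?M \<and> measure ?M F \<le> exp (- real (card ?J)) \<and>
      (\<forall>X\<in>space ?M - F. (g + 6) * card {z \<in> ?J. card {i \<in> ?N T. X i \<in> grid_cell m z} < g} \<le> card ?J)"
      unfolding M Bex_def[symmetric]
      by (intro product_few_sparse_cells[OF prob_space_unit_cube _ common_nbrs_subset J]) auto
  qed
  from bchoice[OF this] obtain F where F': "\<forall>T\<in>\<T>. F T \<in> sets ?M \<and>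
      measure ?M (F T) \<le> exp (- real (card ?J)) \<and>
      (\<forall>X\<in>space ?M - F T. (g + 6) * card {z \<in> ?J. card {i \<in> ?N T. X i \<in> grid_cell m z} < g} \<le> card ?J)" ..
  have F: "F T \<in> sets ?M" "measure ?M (F T) \<le> exp (- real (card ?J))"
    "\<And>X. X \<in> space ?M - F T \<Longrightarrow>
      (g + 6) * card {z \<in> ?J. card {i \<in> ?N T. X i \<in> grid_cell m z} < g} \<le> card ?J"
    if "T \<in> \<T>" for T
    using bspec[OF F' that] by simp_all
  define bad where "bad = (\<Union>T\<in>\<T>. F T)"
  have bad: "bad \<in> sets ?M" using F(1) fin\<T> by (auto simp: bad_def)
  have "measure ?M bad \<le> (\<Sum>T\<in>\<T>. measure ?M (F T))"
    unfolding bad_def using F(1) fin\<T> by (intro M.finite_measure_subadditive_finite) auto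
  also have "\<dots> \<le> card \<T> * exp (- real (card ?J))" using F(2) by (intro sum_bounded_above) auto
  also have "\<dots> \<le> real ((n + 1) ^ k) * exp (- real (card ?J))"
    using card\<T> by (intro mult_right_mono) (simp_all only: of_nat_le_iff exp_ge_zero)
  finally have bad_le: "measure ?M bad \<le> (n + 1) ^ k * exp (- real (m ^ CARD('d)))" by (simp add: cJ)
  define good where "good = {X \<in> space ?M. contains_hamilton_cycle_power k ?V (H \<union> geometric_edges n r X)}"
  have good_sets: "good \<in> sets ?M"
    unfolding good_def by (rule sets_geometric_edges)
  have AE_cell: "AE X in ?M. \<forall>i\<in>?V. X i \<in> (\<Union>z\<in>?J. grid_cell m z)"
    unfolding M using AE_grid_cell[OF m(1)]
    by (intro AE_finite_allI AE_component) auto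
  have imp: "X \<in> good"
    if X: "X \<in> space ?M" "X \<notin> bad" and cover: "\<forall>i\<in>?V. X i \<in> (\<Union>z\<in>?J. grid_cell m z)" for X
  proof -
    define c where "c z = {i \<in> ?V. X i \<in> grid_cell m z}" for z
    have "contains_hamilton_cycle_power k ?V (H \<union> geometric_edges n r X)"
    proof (rule contains_hamilton_cycle_power_cells[OF _ _ k \<alpha> deg t g J(1,2), where c = c])
      show "disjoint_family_on c ?J" using J(3) by (fastforce simp: disjoint_family_on_def c_def)
      show "?V = (\<Union>z\<in>?J. c z)" using cover by (auto simp: c_def)
      fix z u v assume "u \<in> c z" "v \<in> c z" "u \<noteq> v"
      then have "norm (X u - X v) \<le> r" "u \<in> ?V" "v \<in> ?V"
        using norm_diff_grid_cell_le[of "X u" m z "X v"] m(2) by (auto simp: c_def)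
      then show "{u, v} \<in> H \<union> geometric_edges n r X"
        using \<open>u \<noteq> v\<close> unfolding geometric_edges_def by blast
    next
      fix T assume "T \<subseteq> ?V" "card T \<le> k" "\<alpha> / 2 / 2 ^ t * card ?V \<le> card (?N T)"
      then have T: "T \<in> \<T>" by (simp add: \<T>_def)
      have "c z \<inter> ?N T = {i \<in> ?N T. X i \<in> grid_cell m z}" for z
        using common_nbrs_subset[of ?V H T] by (auto simp: c_def)
      then show "(g + 6) * card {z \<in> ?J. card (c z \<inter> ?N T) < g} \<le> card ?J"
        using F(3)[OF T, of X] X T by (auto simp: bad_def)
    qed auto
    then show ?thesis using X by (simp add: good_def)
  qed
  have "1 - measure ?M bad = measure ?M (space ?M - bad)" using bad by (rule M.prob_compl[symmetric])
  \<comment> \<open>The inclusion holds only almost everywhere, because points on grid hyperplanes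
    lie in no cell.\<close>
  also have "\<dots> \<le> measure ?M good"
  proof (rule M.finite_measure_mono_AE[OF _ good_sets])
    show "AE X in ?M. X \<in> space ?M - bad \<longrightarrow> X \<in> good"
      using AE_cell by (rule eventually_mono) (use imp in blast)
  qed
  finally show ?thesis using bad_le unfolding good_def by linarith
qed

theorem theorem1p3:
  fixes k :: nat and \<alpha> :: real
  assumes "1 \<le> k" and "0 < \<alpha>" and "\<alpha> < 1"
  shows "\<exists>C>0. \<forall>(H :: nat \<Rightarrow> nat set set) (r :: nat \<Rightarrow> real).
    (\<forall>\<^sub>F n in sequentially.
        simple_graph {1..n} (H n) \<and>
        real (min_degree {1..n} (H n)) \<ge> \<alpha> * real n \<and>
        r n \<ge> (C / real n) powr (1 / real CARD('d::finite))) \<longrightarrow>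
    ((\<lambda>n. measure (random_points n :: (nat \<Rightarrow> real ^ 'd) measure)
        {X \<in> space (random_points n).
           contains_hamilton_cycle_power k {1..n} (H n \<union> geometric_edges n (r n) X)})
      \<longlonglongrightarrow> 1)"
proof -
  define d where "d = CARD('d)"
  have d: "0 < d" by (simp add: d_def)
  define t where "t = nat \<lceil>2 * k / \<alpha>\<rceil>"
  define g where "g = 2 * t + 13 * k"
  \<comment> \<open>\<open>L\<close> is chosen so that \<open>m ^ d \<le> n / L\<close> is exactly
    the condition \<open>size\<close> of the probability bound.\<close>
  define L where "L = 2 * (g + 2 * (g + 6)) / (\<alpha> / 2 / 2 ^ t)"
  \<comment> \<open>With \<open>x ^ d = n / L\<close>, rounding \<open>x\<close> down to
    \<open>m\<close> at most halves it, so the diameter bound \<open>d / m\<close> is at most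
    \<open>2 * d / x\<close>, whose \<open>d\<close>-th power is \<open>C / n\<close>.\<close>
  define C where "C = (2 * d) ^ d * L"
  have t: "2 * real k \<le> \<alpha> * t"
  proof -
    have "2 * k / \<alpha> \<le> t" unfolding t_def by linarith
    then show ?thesis using \<open>0 < \<alpha>\<close> by (simp add: field_simps)
  qed
  have L: "0 < L" using \<open>0 < \<alpha>\<close> by (simp add: L_def)
  have C: "0 < C" using L d by (simp add: C_def)
  define m where "m n = nat \<lfloor>(n / L) powr (1 / d)\<rfloor>" for n :: nat
  have m: "0 < m n" "m n ^ d \<le> n / L" "n / L / 2 ^ d \<le> m n ^ d" "d / m n \<le> (C / n) powr (1 / d)"
    if n: "L \<le> n" for n :: nat
  proof -
    define x where "x = (n / L) powr (1 / d)"
    have x1: "1 \<le> x" unfolding x_def using n L by (intro ge_one_powr_ge_zero) auto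
    have n0: "0 < real n" using n L by linarith
    have xd: "x ^ d = n / L"
    proof -
      have "x ^ d = x powr d" using x1 by (simp add: powr_realpow)
      then show ?thesis unfolding x_def using n0 L d by (simp add: powr_powr)
    qed
    have mx: "m n \<le> x" "x / 2 \<le> m n" "1 \<le> m n"
    proof -
      have "1 \<le> \<lfloor>x\<rfloor>" using x1 by (simp add: le_floor_iff)
      moreover have "int (m n) = \<lfloor>x\<rfloor>" using \<open>1 \<le> \<lfloor>x\<rfloor>\<close> by (simp add: m_def x_def)
      ultimately have "1 \<le> m n" "real (m n) = of_int \<lfloor>x\<rfloor>" by linarith+
      moreover have "of_int \<lfloor>x\<rfloor> \<le> x" "x < of_int \<lfloor>x\<rfloor> + 1" by linarith+
      ultimately show "m n \<le> x" "x / 2 \<le> m n" "1 \<le> m n" by linarith+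
    qed
    show "0 < m n" using mx by linarith
    show "m n ^ d \<le> n / L" using power_mono[OF mx(1), of d] xd by simp
    have "(x / 2) ^ d \<le> m n ^ d" using power_mono[OF mx(2), of d] x1 by simp
    then show "n / L / 2 ^ d \<le> m n ^ d" using xd by (simp add: power_divide)
    have "d / m n \<le> d / (x / 2)" using mx x1 by (intro divide_left_mono) auto
    also have "\<dots> = 2 * d / x" by simp
    also have "\<dots> = (C / n) powr (1 / d)"
    proof -
      have "C / n = (2 * d / x) ^ d" using xd n0 L x1 by (simp add: C_def power_divide)
      also have "\<dots> = (2 * d / x) powr d" using d x1 by (simp add: powr_realpow)
      finally show ?thesis using d x1 by (simp add: powr_powr)
    qed
    finally show "d / m n \<le> (C / n) powr (1 / d)" .
  qed
  have "((\<lambda>n. measure (random_points n :: (nat \<Rightarrow> real ^ 'd) measure)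
        {X \<in> space (random_points n).
           contains_hamilton_cycle_power k {1..n} (H n \<union> geometric_edges n (r n) X)}) \<longlonglongrightarrow> 1)"
    (is "?p \<longlonglongrightarrow> 1")
    if ev: "\<forall>\<^sub>F n in sequentially. simple_graph {1..n} (H n) \<and>
        real (min_degree {1..n} (H n)) \<ge> \<alpha> * real n \<and> r n \<ge> (C / real n) powr (1 / real CARD('d))"
    for H :: "nat \<Rightarrow> nat set set" and r :: "nat \<Rightarrow> real"
  proof (rule tendsto_sandwich)
    \<comment> \<open>The number of cells is at least \<open>c * n\<close>, so the exponential
      factor beats the polynomial number of sets \<open>T\<close>.\<close>
    define c where "c = 1 / (L * 2 ^ d)"
    have c: "0 < c" using L by (simp add: c_def)
    show "(\<lambda>n. 1 - (real n + 1) ^ k * exp (- (c * real n))) \<longlonglongrightarrow> 1"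
      using c by real_asymp
    show "\<forall>\<^sub>F n in sequentially. 1 - (real n + 1) ^ k * exp (- (c * real n)) \<le> ?p n"
      \<comment> \<open>From \<open>L \<le> n\<close> on, the rounded-down grid size is at least
        1.\<close>
      using ev eventually_ge_at_top[of "nat \<lceil>L\<rceil>"]
    proof eventually_elim
      case (elim n)
      have n: "L \<le> n" using elim(2) by linarith
      note mn = m[OF n]
      have "2 * m n ^ d * (g + 2 * (g + 6)) = \<alpha> / 2 / 2 ^ t * (L * m n ^ d)"
        using \<open>0 < \<alpha>\<close> by (simp add: L_def field_simps)
      also have "\<dots> \<le> \<alpha> / 2 / 2 ^ t * n"
        using mn(2) L \<open>0 < \<alpha>\<close> by (intro mult_left_mono) (auto simp: field_simps)
      finally have size: "2 * m n ^ d * (g + 2 * (g + 6)) \<le> \<alpha> / 2 / 2 ^ t * n" by simp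
      have r: "real d / m n \<le> r n" using elim(1) mn(4) by (simp add: d_def)
      have "c * n \<le> m n ^ d" using mn(3) by (simp add: c_def)
      then have "(real n + 1) ^ k * exp (- real (m n ^ d)) \<le> (real n + 1) ^ k * exp (- (c * n))"
        by (intro mult_left_mono) auto
      then have "1 - (real n + 1) ^ k * exp (- (c * n)) \<le> 1 - (real n + 1) ^ k * exp (- real (m n ^ d))"
        by simp
      also have "\<dots> \<le> ?p n"
        using prob_contains_hamilton_cycle_power_ge[where 'd = 'd, OF assms _ _ t g_def mn(1), of n "H n" "r n"]
          elim(1) size r by (simp add: d_def add.commute)
      finally show ?case .
    qed
    show "\<forall>\<^sub>F n in sequentially. ?p n \<le> 1"
    proof (rule always_eventually, rule allI)
      fix n
      have "prob_space (random_points n :: (nat \<Rightarrow> real ^ 'd) measure)"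
        unfolding random_points_def by (rule prob_space_PiM) (rule prob_space_unit_cube)
      then show "?p n \<le> 1" by (rule prob_space.prob_le_1)
    qed
    show "(\<lambda>_. 1) \<longlonglongrightarrow> (1::real)" by simp
  qed
  then show ?thesis using C by blast
qed

end
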